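(* Let $\Phi : \mathscr{S} \ni s \mapsto T_s \in \mathscr{L}(X)$ be a homomorphism of a strongly [resp. weakly] right amenable SGT $\mathscr{S}$ into $\mathscr{L}(X)$, where $X$ is a Banach space. Suppose $Y$ is a closed linear subspace of $X$ and: (p0) $\Phi$ is continuous in the strong operator topology [resp. operator norm topology] of $\mathscr{L}(X)$; (p1) for any $s \in \mathscr{S}$, $T_s(Y) = Y$ and the restriction $T_s|_Y$ of $T_s$ to $Y$ is an isomorphism; (p2) $Y$ is a dual Banach space, that is, $Y$ is linearly isometric to the dual space of some Banach space (and thus the closed unit ball $B_Y$ of $Y$ is compact with respect to a certain locally convex topology of $Y$, called weak* ); (p3) for any $s \in \mathscr{S}$, $T_s|_Y$ is weak* continuous on $B_Y$; (p4) the function $\mathscr{S} \ni s \mapsto \|(T_s|_Y)^{-1}\| \in \mathbb{R}$ is locally bounded. Then the following conditions are equivalent: (i) there exists a projection $P : X \to Y$ such that $PT_s = T_s P$ for all $s \in \mathscr{S}$; (ii) there is a projection $Q : X \to Y$ such that $\sup_{s \in \mathscr{S}} \|(T_s|_Y)^{-1} Q T_s\| < \infty$. Moreover, if (ii) holds, then there exists a projection $P_0 : X \to Y$ such that $P_0$ commutes with all operators $T_s$ and $\|P_0\| \leqslant \|P\|$ for any other projection $P : X \to Y$ commuting with all $T_s$. (The statement consists of two versions: "strongly / strong operator topology" and "weakly / operator norm topology".)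
   Context: An SGT (semigroup with topology) is a non-empty semigroup $\mathscr{S}$ that is also a (possibly non-Hausdorff) topological space; no compatibility between the multiplication and the topology is assumed. For $f:\mathscr{S}\to\mathbb{R}$ and $s\in\mathscr{S}$ let $f_s(t)=f(ts)$. $C_b(\mathscr{S})$ is the space of bounded continuous real-valued functions on $\mathscr{S}$ with the sup-norm, and $C_r(\mathscr{S})=\{f\in C_b(\mathscr{S}): f_s \text{ is continuous for every } s\in\mathscr{S}\}$. Let $C_{norm}(\mathscr{S})$ [resp. $C_{weak}(\mathscr{S})$] be the set of all $f\in C_r(\mathscr{S})$ such that $s\mapsto f_s$ and, for all $t\in\mathscr{S}$, $s\mapsto f_{st}$ are continuous from $\mathscr{S}$ to $C_r(\mathscr{S})$ equipped with its norm [resp. weak] topology. A mean on a linear subspace $\mathscr{F}$ of $C_r(\mathscr{S})$ is a linear functional $\phi:\mathscr{F}\to\mathbb{R}$ with $\inf f(\mathscr{S})\leqslant\phi(f)\leqslant\sup f(\mathscr{S})$ for all $f\in\mathscr{F}$; if $\mathscr{F}$ is right invariant ($f_s\in\mathscr{F}$ for $f\in\mathscr{F}$, $s\in\mathscr{S}$), the mean is right invariant if $\phi(f_s)=\phi(f)$ for all $f\in\mathscr{F}$, $s\in\mathscr{S}$. $\mathscr{S}$ is weakly [resp. strongly] right amenable if there is a right invariant mean on $C_{norm}(\mathscr{S})$ [resp. $C_{weak}(\mathscr{S})$]. Banach spaces are real or complex. $\mathscr{L}(X)$ is the algebra of bounded linear operators on $X$; $s\mapsto T_s$ is a homomorphism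 if $T_{st}=T_sT_t$ for all $s,t$. A projection $P:X\to Y$ is a bounded linear operator with $Py=y$ for all $y\in Y$. "Isomorphism" means a linear bijection of $Y$ onto $Y$ bounded with bounded inverse. *)

theory Defs
  imports "HOL-Analysis.Analysis"
begin

text \<open>The scalar field. A finite-dimensional commutative real division algebra with multiplicative
  norm is isometrically isomorphic to the real or the complex numbers, so a variable of this class
  stands for either of the two fields.\<close>

class real_or_complex = real_normed_field + euclidean_space

instance real :: real_or_complex ..
instance complex :: real_or_complex ..

text \<open>A Banach space over \<open>'k\<close>: the class \<open>banach\<close> only knows real scalars, so the \<open>'k\<close>-scalar
  multiplication is a parameter extending the real one.\<close>

locale banach_space_over = vector_space smul
  for smul :: "'k::real_or_complex \<Rightarrow> 'a::banach \<Rightarrow> 'a" +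
  assumes scale_of_real: "smul (of_real r) x = r *\<^sub>R x"
    and norm_scale: "norm (smul c x) = norm c * norm x"

text \<open>Bounded operators and functionals are elements of the library type of bounded real-linear
  maps that are homogeneous over \<open>'k\<close>; their norm is the library one.\<close>

definition bounded_operators ::
    "('k \<Rightarrow> 'a::real_normed_vector \<Rightarrow> 'a) \<Rightarrow> ('a \<Rightarrow>\<^sub>L 'a) set" where
  "bounded_operators smul = {T. \<forall>c x. blinfun_apply T (smul c x) = smul c (blinfun_apply T x)}"

definition dual_space ::
    "('k::real_or_complex \<Rightarrow> 'z::real_normed_vector \<Rightarrow> 'z) \<Rightarrow> ('z \<Rightarrow>\<^sub>L 'k) set" where
  "dual_space smul = {f. \<forall>c z. blinfun_apply f (smul c z) = c * blinfun_apply f z}"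

definition is_projection ::
    "('k \<Rightarrow> 'a::real_normed_vector \<Rightarrow> 'a) \<Rightarrow> 'a set \<Rightarrow> ('a \<Rightarrow>\<^sub>L 'a) \<Rightarrow> bool" where
  "is_projection smul Y P \<longleftrightarrow>
     P \<in> bounded_operators smul \<and> range (blinfun_apply P) \<subseteq> Y \<and> (\<forall>y\<in>Y. blinfun_apply P y = y)"

definition is_commuting_projection ::
    "('k \<Rightarrow> 'a::real_normed_vector \<Rightarrow> 'a) \<Rightarrow> 'a set \<Rightarrow> ('s \<Rightarrow> 'a \<Rightarrow>\<^sub>L 'a) \<Rightarrow> ('a \<Rightarrow>\<^sub>L 'a) \<Rightarrow> bool" where
  "is_commuting_projection smul Y \<Phi> P \<longleftrightarrow>
     is_projection smul Y P \<and> (\<forall>s. P o\<^sub>L \<Phi> s = \<Phi> s o\<^sub>L P)"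

definition restriction_inverse ::
    "'a set \<Rightarrow> ('a::real_normed_vector \<Rightarrow>\<^sub>L 'a) \<Rightarrow> 'a \<Rightarrow> 'a" where
  "restriction_inverse Y T = inv_into Y (blinfun_apply T)"

definition restricts_to_isomorphism ::
    "'a set \<Rightarrow> ('a::real_normed_vector \<Rightarrow>\<^sub>L 'a) \<Rightarrow> bool" where
  "restricts_to_isomorphism Y T \<longleftrightarrow> bij_betw (blinfun_apply T) Y Y \<and>
     (\<exists>B. \<forall>y\<in>Y. norm (restriction_inverse Y T y) \<le> B * norm y)"

text \<open>The operator norm of a map defined on a subspace; compare \<open>onorm\<close>, the case \<open>Y = UNIV\<close>.\<close>

definition onorm_on :: "'a set \<Rightarrow> ('a::real_normed_vector \<Rightarrow> 'a) \<Rightarrow> real" where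
  "onorm_on Y g = (SUP y\<in>Y. norm (g y) / norm y)"

definition isometry_onto_dual ::
    "('k::real_or_complex \<Rightarrow> 'a::real_normed_vector \<Rightarrow> 'a) \<Rightarrow>
     ('k \<Rightarrow> 'z::real_normed_vector \<Rightarrow> 'z) \<Rightarrow> 'a set \<Rightarrow> ('a \<Rightarrow> 'z \<Rightarrow>\<^sub>L 'k) \<Rightarrow> bool" where
  "isometry_onto_dual scaleX scaleZ Y J \<longleftrightarrow>
     bij_betw J Y (dual_space scaleZ) \<and>
     (\<forall>x\<in>Y. \<forall>y\<in>Y. J (x + y) = J x + J y) \<and>
     (\<forall>c. \<forall>y\<in>Y. \<forall>z. blinfun_apply (J (scaleX c y)) z = c * blinfun_apply (J y) z) \<and>
     (\<forall>y\<in>Y. norm (J y) = norm y)"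

text \<open>The topology of pointwise convergence on the predual (\<open>euclidean\<close> on a function type is the
  product topology), carried over to \<open>Y\<close> by the identification \<open>J\<close> of \<open>Y\<close> with the dual.\<close>

definition weak_star_topology ::
    "'a set \<Rightarrow> ('a \<Rightarrow> 'z::real_normed_vector \<Rightarrow>\<^sub>L 'k::real_normed_vector) \<Rightarrow> 'a topology" where
  "weak_star_topology Y J = pullback_topology Y (\<lambda>y. blinfun_apply (J y)) euclidean"

definition locally_bounded :: "('s::topological_space \<Rightarrow> real) \<Rightarrow> bool" where
  "locally_bounded g \<longleftrightarrow> (\<forall>s. \<exists>U. open U \<and> s \<in> U \<and> bounded (g ` U))"

text \<open>Semigroups with topology are types of sort \<open>{semigroup_mult, topological_space}\<close>.
  \<open>Bcontfun\<close> is unspecified on functions that are not bounded and continuous, so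
  \<open>right_translate\<close> is meaningful only on \<open>C_r\<close>.\<close>

definition C_r :: "('s::{semigroup_mult,topological_space} \<Rightarrow>\<^sub>C real) set" where
  "C_r = {f. \<forall>s. continuous_on UNIV (\<lambda>t. apply_bcontfun f (t * s))}"

definition right_translate ::
    "'s::{semigroup_mult,topological_space} \<Rightarrow> ('s \<Rightarrow>\<^sub>C real) \<Rightarrow> ('s \<Rightarrow>\<^sub>C real)" where
  "right_translate s f = Bcontfun (\<lambda>t. apply_bcontfun f (t * s))"

definition bounded_functionals_on :: "'v::real_normed_vector set \<Rightarrow> ('v \<Rightarrow> real) set" where
  "bounded_functionals_on V = {\<phi>.
     (\<forall>f\<in>V. \<forall>g\<in>V. \<phi> (f + g) = \<phi> f + \<phi> g) \<and>
     (\<forall>c. \<forall>f\<in>V. \<phi> (c *\<^sub>R f) = c * \<phi> f) \<and>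
     (\<exists>B. \<forall>f\<in>V. \<bar>\<phi> f\<bar> \<le> B * norm f)}"

definition weak_topology_on :: "'v::real_normed_vector set \<Rightarrow> 'v topology" where
  "weak_topology_on V = topology_generated_by
     {{f \<in> V. \<phi> f \<in> U} |\<phi> U. \<phi> \<in> bounded_functionals_on V \<and> open U}"

definition C_orbit_continuous ::
    "('s::{semigroup_mult,topological_space} \<Rightarrow>\<^sub>C real) topology \<Rightarrow> ('s \<Rightarrow>\<^sub>C real) set" where
  "C_orbit_continuous \<tau> = {f \<in> C_r.
     continuous_map euclidean \<tau> (\<lambda>s. right_translate s f) \<and>
     (\<forall>t. continuous_map euclidean \<tau> (\<lambda>s. right_translate (s * t) f))}"

definition C_norm :: "('s::{semigroup_mult,topological_space} \<Rightarrow>\<^sub>C real) set" where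
  "C_norm = C_orbit_continuous (top_of_set C_r)"

definition C_weak :: "('s::{semigroup_mult,topological_space} \<Rightarrow>\<^sub>C real) set" where
  "C_weak = C_orbit_continuous (weak_topology_on C_r)"

lemma apply_right_translate:
  assumes "f \<in> C_r"
  shows "apply_bcontfun (right_translate s f) t = apply_bcontfun f (t * s)"
proof -
  have "bounded (range (\<lambda>t. apply_bcontfun f (t * s)))"
    by (rule bounded_subset[OF bounded_apply_bcontfun[of f]]) auto
  with assms have "(\<lambda>t. apply_bcontfun f (t * s)) \<in> bcontfun"
    by (simp add: C_r_def bcontfun_def)
  then show ?thesis by (simp add: right_translate_def Bcontfun_inverse)
qed

lemma right_translate_mem_C_r: "f \<in> C_r \<Longrightarrow> right_translate s f \<in> C_r"
  by (subst C_r_def) (simp add: apply_right_translate mult.assoc, simp add: C_r_def)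

lemma right_translate_right_translate:
  "f \<in> C_r \<Longrightarrow> right_translate s (right_translate t f) = right_translate (s * t) f"
  by (rule bcontfun_eqI) (simp add: apply_right_translate right_translate_mem_C_r mult.assoc)

lemma right_translate_mem_C_orbit_continuous:
  "f \<in> C_orbit_continuous \<tau> \<Longrightarrow> right_translate s f \<in> C_orbit_continuous \<tau>"
  by (simp add: C_orbit_continuous_def right_translate_mem_C_r right_translate_right_translate
      mult.assoc)

definition is_mean :: "('s::topological_space \<Rightarrow>\<^sub>C real) set \<Rightarrow> (('s \<Rightarrow>\<^sub>C real) \<Rightarrow> real) \<Rightarrow> bool" where
  "is_mean F \<phi> \<longleftrightarrow>
     (\<forall>f\<in>F. \<forall>g\<in>F. \<phi> (f + g) = \<phi> f + \<phi> g) \<and>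
     (\<forall>c. \<forall>f\<in>F. \<phi> (c *\<^sub>R f) = c * \<phi> f) \<and>
     (\<forall>f\<in>F. Inf (range (apply_bcontfun f)) \<le> \<phi> f \<and> \<phi> f \<le> Sup (range (apply_bcontfun f)))"

definition is_right_invariant_mean ::
    "('s::{semigroup_mult,topological_space} \<Rightarrow>\<^sub>C real) set \<Rightarrow> (('s \<Rightarrow>\<^sub>C real) \<Rightarrow> real) \<Rightarrow> bool" where
  "is_right_invariant_mean F \<phi> \<longleftrightarrow> is_mean F \<phi> \<and> (\<forall>f\<in>F. \<forall>s. \<phi> (right_translate s f) = \<phi> f)"

definition weakly_right_amenable :: "'s::{semigroup_mult,topological_space} itself \<Rightarrow> bool" where
  "weakly_right_amenable _ \<longleftrightarrow> (\<exists>\<phi>. is_right_invariant_mean (C_norm :: ('s \<Rightarrow>\<^sub>C real) set) \<phi>)"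

definition strongly_right_amenable :: "'s::{semigroup_mult,topological_space} itself \<Rightarrow> bool" where
  "strongly_right_amenable _ \<longleftrightarrow> (\<exists>\<phi>. is_right_invariant_mean (C_weak :: ('s \<Rightarrow>\<^sub>C real) set) \<phi>)"

end

theory Submission
  imports Defs
begin

text \<open>
Write \<open>T\<^sub>s\<close> for the operators and \<open>Z\<close> for the predual of \<open>Y\<close>. A commuting projection \<open>P\<close> satisfies
\<open>(T\<^sub>s|Y)\<inverse> P T\<^sub>s = P\<close>, so it is its own witness for the boundedness condition. Conversely, let \<open>Q\<close> be
a projection whose conjugates \<open>R\<^sub>s = (T\<^sub>s|Y)\<inverse> Q T\<^sub>s\<close> are uniformly bounded. They are projections onto
\<open>Y\<close> again, and \<open>P\<close> is their average: for \<open>x\<close> in \<open>X\<close> the mean of the coefficient \<open>t \<mapsto> \<langle>R\<^sub>t x, z\<rangle>\<close> is a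
bounded functional of \<open>z\<close>, that is, a point \<open>P x\<close> of \<open>Y\<close>. Each \<open>T\<^sub>s|Y\<close> is the adjoint of an invertible
operator \<open>S\<^sub>s\<close> of \<open>Z\<close>, so \<open>\<langle>R\<^sub>t\<^sub>s x, z\<rangle> = \<langle>R\<^sub>t T\<^sub>s x, S\<^sub>s\<inverse> z\<rangle>\<close>: translating the coefficient of \<open>(x, z)\<close>
by \<open>s\<close> gives the coefficient of \<open>(T\<^sub>s x, S\<^sub>s\<inverse> z)\<close>. Invariance of the mean therefore says that
\<open>\<langle>P T\<^sub>s x, z\<rangle> = \<langle>P x, S\<^sub>s z\<rangle> = \<langle>T\<^sub>s P x, z\<rangle>\<close>, and \<open>P\<close> fixes \<open>Y\<close> because the coefficients of points of
\<open>Y\<close> are constant. This is \<open>equivariant_average\<close>.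

The mean is only defined on \<open>C_norm\<close> or \<open>C_weak\<close>, and by the translation formula a coefficient lies there
once \<open>s \<mapsto> coefficient (T\<^sub>s x) (S\<^sub>s\<inverse> z)\<close> is continuous. If \<open>s \<mapsto> T\<^sub>s\<close> is norm continuous, then so is
\<open>s \<mapsto> S\<^sub>s\<close>, and a coefficient is bounded bilinear in \<open>(x, z)\<close>. If \<open>s \<mapsto> T\<^sub>s\<close> is only strongly
continuous, nothing is known about \<open>s \<mapsto> S\<^sub>s\<inverse> z\<close>. But a bounded functional \<open>\<psi>\<close> on \<open>C_r\<close> can be applied
to coefficients just as the mean is; it turns them into an operator \<open>p : X \<rightarrow> Y\<close>, and
\<open>\<psi> (coefficient (T\<^sub>s x) (S\<^sub>s\<inverse> z)) = \<langle>(T\<^sub>s|Y)\<inverse> p T\<^sub>s x, z\<rangle>\<close> is continuous since \<open>s \<mapsto> (T\<^sub>s|Y)\<inverse>\<close> is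
strongly continuous, its norm being locally bounded.

Weak* continuity of \<open>T\<^sub>s|Y\<close> on the unit ball is enough for a preadjoint \<open>S\<^sub>s\<close> to exist. This is the
Krein-Smulian theorem for functionals (\<open>krein_smulian_functional\<close>), which rests on the Hahn-Banach theorem;
the latter is derived from the existence of minimal sublinear functionals.

The scalar field is eliminated at the start: taking real parts identifies the dual of \<open>Z\<close> over the scalars
isometrically with its real dual, so \<open>Y\<close> is the range of an isometric embedding of \<open>'z \<Rightarrow>\<^sub>L real\<close>.
Homogeneity over the scalars becomes one more equation \<open>\<langle>p (c x), z\<rangle> = \<langle>p x, c z\<rangle>\<close> of the same kind as
\<open>\<langle>p (T\<^sub>s x), z\<rangle> = \<langle>p x, S\<^sub>s z\<rangle>\<close>. So the commuting projections correspond to the bounded bilinear forms on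
\<open>X \<times> Z\<close> that solve a family of pointwise equations, and among these Tychonoff's theorem provides one of
least norm (\<open>minimal_norm_attained\<close>).
\<close>

section \<open>The Hahn-Banach theorem\<close>

definition sublinear :: "('v::real_vector \<Rightarrow> real) \<Rightarrow> bool" where
  "sublinear p \<longleftrightarrow> (\<forall>x y. p (x + y) \<le> p x + p y) \<and> (\<forall>c x. 0 \<le> c \<longrightarrow> p (c *\<^sub>R x) = c * p x)"

lemma
  assumes "sublinear p"
  shows sublinear_add: "p (x + y) \<le> p x + p y"
    and sublinear_scaleR: "0 \<le> c \<Longrightarrow> p (c *\<^sub>R x) = c * p x"
    and sublinear_zero: "p 0 = 0"
    and sublinear_minus: "- p (- x) \<le> p x"
proof -
  show 1: "p (x + y) \<le> p x + p y" for x y using assms by (simp add: sublinear_def)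
  show 2: "0 \<le> c \<Longrightarrow> p (c *\<^sub>R x) = c * p x" for c x using assms by (simp add: sublinear_def)
  show 3: "p 0 = 0" using 2[of 0 0] by simp
  show "- p (- x) \<le> p x" using 1[of x "- x"] 3 by simp
qed

text \<open>The sublinear functionals below arise as pointwise infima: over a ray, over a chain, over a subspace. The
hypotheses are what these families share. They bound the infimum only from
above, which suffices: homogeneity with \<open>c\<close> and with \<open>1 / c\<close> gives equality, and at \<open>c = 0\<close> the factors
\<open>2\<close> and \<open>1 / 2\<close> force the value \<open>0\<close>.\<close>

lemma sublinear_INF:
  fixes h :: "'k \<Rightarrow> 'v::real_vector \<Rightarrow> real"
  assumes "K \<noteq> {}" and bdd: "\<And>x. bdd_below ((\<lambda>k. h k x) ` K)"
    and add: "\<And>k l x y. k \<in> K \<Longrightarrow> l \<in> K \<Longrightarrow> \<exists>m\<in>K. h m (x + y) \<le> h k x + h l y"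
    and scale: "\<And>c k x. 0 < c \<Longrightarrow> k \<in> K \<Longrightarrow> \<exists>m\<in>K. h m (c *\<^sub>R x) \<le> c * h k x"
  shows "sublinear (\<lambda>x. INF k\<in>K. h k x)"
proof -
  define q where "q x = (INF k\<in>K. h k x)" for x
  have lower: "q x \<le> h k x" if "k \<in> K" for k x
    unfolding q_def using bdd that by (rule cINF_lower)
  have greatest: "a \<le> q x" if "\<And>k. k \<in> K \<Longrightarrow> a \<le> h k x" for a x
    unfolding q_def using \<open>K \<noteq> {}\<close> that by (rule cINF_greatest)
  have "q (x + y) \<le> q x + q y" for x y
  proof -
    have "q (x + y) - h l y \<le> q x" if "l \<in> K" for l
    proof (rule greatest)
      fix k assume "k \<in> K"
      then obtain m where "m \<in> K" "h m (x + y) \<le> h k x + h l y"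
        using add \<open>k \<in> K\<close> \<open>l \<in> K\<close> by blast
      then show "q (x + y) - h l y \<le> h k x" using lower[of m "x + y"] by linarith
    qed
    then have "q (x + y) - q x \<le> q y" by (intro greatest) (simp add: algebra_simps)
    then show ?thesis by simp
  qed
  moreover have scale_le: "q (c *\<^sub>R x) \<le> c * q x" if "0 < c" for c x
  proof -
    have "q (c *\<^sub>R x) / c \<le> q x"
    proof (rule greatest)
      fix k assume "k \<in> K"
      then obtain m where "m \<in> K" "h m (c *\<^sub>R x) \<le> c * h k x" using scale \<open>0 < c\<close> by blast
      then have "q (c *\<^sub>R x) \<le> c * h k x" using lower[of m "c *\<^sub>R x"] by simp
      then show "q (c *\<^sub>R x) / c \<le> h k x" using that by (simp add: field_simps)
    qed
    then show ?thesis using that by (simp add: field_simps)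
  qed
  have "q (c *\<^sub>R x) = c * q x" if "0 \<le> c" for c x
  proof (cases "c = 0")
    case True
    then show ?thesis using scale_le[of 2 0] scale_le[of "1/2" 0] by simp
  next
    case False
    then have "0 < c" using that by simp
    have "c * q (inverse c *\<^sub>R (c *\<^sub>R x)) \<le> c * (inverse c * q (c *\<^sub>R x))"
      using \<open>0 < c\<close> scale_le[of "inverse c" "c *\<^sub>R x"] by (intro mult_left_mono) auto
    then show ?thesis using scale_le[OF \<open>0 < c\<close>, of x] \<open>0 < c\<close> by (simp add: field_simps)
  qed
  ultimately show ?thesis by (simp add: sublinear_def q_def)
qed

text \<open>The functional is the infimum of \<open>p (x + t y) - t p y\<close> over \<open>t \<ge> 0\<close>. At \<open>x = - y\<close> it is at most \<open>- p y\<close>, so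
every linear functional below it takes the value \<open>p y\<close> at \<open>y\<close>.\<close>

lemma sublinear_below_decreasing_at:
  assumes p: "sublinear (p :: 'v::real_vector \<Rightarrow> real)"
  obtains q where "sublinear q" "q \<le> p" "\<And>x. q x \<le> p (x + y) - p y"
proof
  let ?h = "\<lambda>t x. p (x + t *\<^sub>R y) - t * p y"
  have bdd: "bdd_below ((\<lambda>t. ?h t x) ` {0..})" for x
  proof (rule bdd_belowI2)
    fix t :: real assume "t \<in> {0..}"
    then show "- p (- x) \<le> ?h t x"
      using sublinear_add[OF p, of "- x" "x + t *\<^sub>R y"] sublinear_scaleR[OF p, of t y] by simp
  qed
  show "sublinear (\<lambda>x. INF t\<in>{0..}. ?h t x)"
  proof (rule sublinear_INF[OF _ bdd])
    fix k l :: real and x z assume "k \<in> {0..}" "l \<in> {0..}"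
    moreover have "?h (k + l) (x + z) \<le> ?h k x + ?h l z"
      using sublinear_add[OF p, of "x + k *\<^sub>R y" "z + l *\<^sub>R y"] by (simp add: algebra_simps)
    ultimately show "\<exists>m\<in>{0..}. ?h m (x + z) \<le> ?h k x + ?h l z"
      by (intro bexI[of _ "k + l"]) auto
  next
    fix c k :: real and x assume "0 < c" "k \<in> {0..}"
    then show "\<exists>m\<in>{0..}. ?h m (c *\<^sub>R x) \<le> c * ?h k x"
      using sublinear_scaleR[OF p, of c "x + k *\<^sub>R y"]
      by (intro bexI[of _ "c * k"]) (auto simp: algebra_simps)
  qed simp
  have lower: "(INF t\<in>{0..}. ?h t x) \<le> ?h t x" if "0 \<le> t" for t x
    by (rule cINF_lower[OF bdd]) (simp add: that)
  show "(\<lambda>x. INF t\<in>{0..}. ?h t x) \<le> p" using lower[of 0] by (simp add: le_fun_def)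
  show "(INF t\<in>{0..}. ?h t x) \<le> p (x + y) - p y" for x using lower[of 1] by simp
qed

text \<open>A minimal \<open>p\<close> coincides with the functional of the previous lemma, so \<open>p x \<le> p (x + y) - p y\<close>, which is
superadditivity.\<close>

lemma linear_of_minimal_sublinear:
  assumes p: "sublinear (p :: 'v::real_vector \<Rightarrow> real)"
    and minimal: "\<And>q. sublinear q \<Longrightarrow> q \<le> p \<Longrightarrow> q = p"
  shows "linear p"
proof -
  have add: "p (x + y) = p x + p y" for x y
  proof -
    obtain q where q: "sublinear q" "q \<le> p" "\<And>x. q x \<le> p (x + y) - p y"
      using sublinear_below_decreasing_at[OF p, of y] by blast
    then have "p x \<le> p (x + y) - p y" using minimal[OF q(1,2)] by metis
    then show ?thesis using sublinear_add[OF p, of x y] by linarith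
  qed
  then have minus: "p (- x) = - p x" for x
    using add[of x "- x"] sublinear_zero[OF p] by simp
  have "p (c *\<^sub>R x) = c * p x" for c x
  proof (cases "0 \<le> c")
    case False
    then show ?thesis using sublinear_scaleR[OF p, of "- c" x] minus[of "c *\<^sub>R x"] by simp
  qed (simp add: sublinear_scaleR[OF p])
  then show ?thesis by (intro linearI) (simp_all add: add)
qed

lemma exists_linear_below_sublinear:
  assumes p: "sublinear (p :: 'v::real_vector \<Rightarrow> real)"
  obtains f where "linear f" "f \<le> p"
proof -
  let ?A = "{q. sublinear q \<and> q \<le> p}"
  have "\<exists>m\<in>?A. \<forall>q\<in>?A. q \<le> m \<longrightarrow> q = m"
  proof (rule predicate_Zorn)
    show "partial_order_on ?A (relation_of (\<lambda>a b. b \<le> a) ?A)"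
      by (rule partial_order_on_relation_ofI) auto
    fix C assume C: "C \<in> Chains (relation_of (\<lambda>a b. b \<le> a) ?A)"
    then have CA: "q \<in> ?A" if "q \<in> C" for q
      using that by (auto simp: Chains_def relation_of_def)
    have chain: "q \<le> r \<or> r \<le> q" if "q \<in> C" "r \<in> C" for q r
      using C that by (auto simp: Chains_def relation_of_def)
    show "\<exists>u\<in>?A. \<forall>q\<in>C. u \<le> q"
    proof (cases "C = {}")
      case True
      then show ?thesis using p by auto
    next
      case False
      have bdd: "bdd_below ((\<lambda>q. q x) ` C)" for x
      proof (rule bdd_belowI2)
        fix q assume "q \<in> C"
        then have "sublinear q" "q (- x) \<le> p (- x)" using CA by (auto simp: le_fun_def)
        then show "- p (- x) \<le> q x" using sublinear_minus[of q x] by linarith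
      qed
      have "sublinear (\<lambda>x. INF q\<in>C. q x)"
      proof (rule sublinear_INF[OF False bdd])
        fix q r x y assume qr: "q \<in> C" "r \<in> C"
        then obtain m where m: "m \<in> C" "m \<le> q" "m \<le> r" using chain by blast
        then have "m (x + y) \<le> q x + r y"
          using sublinear_add[of m x y] CA[OF m(1)] le_funD[OF m(2), of x] le_funD[OF m(3), of y] by simp
        with m show "\<exists>m\<in>C. m (x + y) \<le> q x + r y" by blast
      next
        fix c :: real and q x assume "0 < c" "q \<in> C"
        then show "\<exists>m\<in>C. m (c *\<^sub>R x) \<le> c * q x"
          using CA by (intro bexI[of _ q]) (auto simp: sublinear_scaleR)
      qed
      moreover have lower: "(\<lambda>x. INF q\<in>C. q x) \<le> q" if "q \<in> C" for q
        using cINF_lower[OF bdd that] by (simp add: le_fun_def)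
      moreover have "(\<lambda>x. INF q\<in>C. q x) \<le> p"
        using False lower CA order_trans by blast
      ultimately show ?thesis by blast
    qed
  qed
  then obtain m where m: "sublinear m" "m \<le> p" "\<And>q. sublinear q \<Longrightarrow> q \<le> p \<Longrightarrow> q \<le> m \<Longrightarrow> q = m"
    by blast
  have "linear m"
    by (rule linear_of_minimal_sublinear[OF m(1)]) (use m(2,3) order_trans in blast)
  with m(2) show ?thesis using that by blast
qed

text \<open>Every linear functional below \<open>inf {p (x - n) + f n | n \<in> N}\<close> is below \<open>f\<close> on \<open>N\<close>, hence equal to \<open>f\<close>
there because \<open>N = - N\<close>. A functional on \<open>N\<close> is given as the restriction of a linear map on the whole
space, which is the form in which it arises below.\<close>

lemma hahn_banach_extension:
  assumes p: "sublinear (p :: 'v::real_vector \<Rightarrow> real)" and f: "linear f"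
    and N: "subspace N" and le: "\<And>x. x \<in> N \<Longrightarrow> f x \<le> p x"
  obtains F where "linear F" "F \<le> p" "\<And>x. x \<in> N \<Longrightarrow> F x = f x"
proof -
  let ?h = "\<lambda>n x. p (x - n) + f n"
  have bdd: "bdd_below ((\<lambda>n. ?h n x) ` N)" for x
  proof (rule bdd_belowI2)
    fix n assume "n \<in> N"
    then have "- f n \<le> p (- n)" using le[of "- n"] N by (simp add: subspace_neg linear_neg[OF f])
    then show "- p (- x) \<le> ?h n x" using sublinear_add[OF p, of "x - n" "- x"] by simp
  qed
  have "sublinear (\<lambda>x. INF n\<in>N. ?h n x)"
  proof (rule sublinear_INF[OF _ bdd])
    show "N \<noteq> {}" using subspace_0[OF N] by blast
  next
    fix k l x y assume "k \<in> N" "l \<in> N"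
    then show "\<exists>m\<in>N. ?h m (x + y) \<le> ?h k x + ?h l y"
      using sublinear_add[OF p, of "x - k" "y - l"]
      by (intro bexI[of _ "k + l"]) (auto simp: subspace_add[OF N] linear_add[OF f] algebra_simps)
  next
    fix c :: real and k x assume "0 < c" "k \<in> N"
    then show "\<exists>m\<in>N. ?h m (c *\<^sub>R x) \<le> c * ?h k x"
      using sublinear_scaleR[OF p, of c "x - k"]
      by (intro bexI[of _ "c *\<^sub>R k"])
        (auto simp: subspace_scale[OF N] linear_scale[OF f] algebra_simps)
  qed
  then obtain F where F: "linear F" "F \<le> (\<lambda>x. INF n\<in>N. ?h n x)"
    using exists_linear_below_sublinear by blast
  then have upper: "F x \<le> ?h n x" if "n \<in> N" for n x
    using le_funD[OF F(2), of x] cINF_lower[OF bdd that, of x] by linarith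
  have "F x = f x" if "x \<in> N" for x
    using upper[OF that, of x] upper[OF subspace_neg[OF N that], of "- x"] sublinear_zero[OF p]
    by (simp add: linear_neg[OF F(1)] linear_neg[OF f])
  moreover have "F \<le> p"
    using upper[OF subspace_0[OF N]] by (simp add: le_fun_def linear_0[OF f])
  ultimately show ?thesis using F(1) that by blast
qed

lemma hahn_banach_at_point:
  assumes p: "sublinear (p :: 'v::real_vector \<Rightarrow> real)"
  obtains F where "linear F" "F \<le> p" "F x = p x"
proof -
  obtain q where q: "sublinear q" "q \<le> p" "\<And>y. q y \<le> p (y + x) - p x"
    using sublinear_below_decreasing_at[OF p, of x] by blast
  obtain F where F: "linear F" "F \<le> q" using exists_linear_below_sublinear[OF q(1)] by blast
  have "F \<le> p" using F(2) q(2) by (rule order_trans)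
  moreover have "- F x \<le> - p x"
    using le_funD[OF F(2), of "- x"] q(3)[of "- x"] sublinear_zero[OF p]
    by (simp add: linear_neg[OF F(1)])
  ultimately show ?thesis using that F(1) le_funD[OF \<open>F \<le> p\<close>, of x] by force
qed

lemma abs_le_of_linear_le:
  fixes F :: "'v::real_vector \<Rightarrow> real"
  assumes "linear F" "\<And>x. F x \<le> p x" "\<And>x. p (- x) = p x"
  shows "\<bar>F x\<bar> \<le> p x"
  using assms(2)[of x] assms(2)[of "- x"] assms(3)[of x]
  by (simp add: linear_neg[OF assms(1)] abs_le_iff)

text \<open>For \<open>p = norm\<close> this is a norming functional of \<open>z\<close>; for \<open>p\<close> the distance to a closed subspace it separates
\<open>z\<close> from that subspace.\<close>

lemma norming_functional:
  fixes z :: "'z::real_normed_vector"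
  assumes p: "sublinear p" "\<And>x. p (- x) = p x" "\<And>x. p x \<le> norm x"
  obtains v :: "'z \<Rightarrow>\<^sub>L real" where "norm v \<le> 1" "v z = p z" "\<And>x. \<bar>v x\<bar> \<le> p x"
proof -
  obtain F where F: "linear F" "F \<le> p" "F z = p z" using hahn_banach_at_point[OF p(1)] by blast
  have abs: "\<bar>F x\<bar> \<le> p x" for x
    using F(2) p(2) by (intro abs_le_of_linear_le[OF F(1)]) (auto simp: le_fun_def)
  then have bl: "bounded_linear F"
    using p(3) by (intro bounded_linear_intro[of F 1])
      (auto simp: linear_add[OF F(1)] linear_scale[OF F(1)] intro: order_trans)
  show ?thesis
  proof
    show "norm (Blinfun F) \<le> 1"
      using abs p(3) by (intro norm_blinfun_bound)
        (auto simp: bounded_linear_Blinfun_apply[OF bl] intro: order_trans)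
  qed (use abs F in \<open>simp_all add: bounded_linear_Blinfun_apply[OF bl]\<close>)
qed

lemma sublinear_norm: "sublinear (\<lambda>x. c * norm x)" if "0 \<le> c"
  using that by (auto simp: sublinear_def norm_triangle_ineq mult_left_mono simp flip: distrib_left)

lemma norm_le_of_functionals:
  fixes z :: "'z::real_normed_vector"
  assumes "\<And>v :: 'z \<Rightarrow>\<^sub>L real. norm v \<le> 1 \<Longrightarrow> blinfun_apply v z \<le> c"
  shows "norm z \<le> c"
proof -
  obtain v :: "'z \<Rightarrow>\<^sub>L real" where "norm v \<le> 1" "v z = norm z"
    using norming_functional[of norm z] sublinear_norm[of 1] by auto
  then show ?thesis using assms by metis
qed

lemma eq_of_functionals:
  fixes y z :: "'z::real_normed_vector"
  assumes "\<And>v :: 'z \<Rightarrow>\<^sub>L real. blinfun_apply v y = blinfun_apply v z"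
  shows "y = z"
proof -
  have "norm (y - z) \<le> 0" by (rule norm_le_of_functionals) (simp add: assms blinfun.diff_right)
  then show ?thesis by simp
qed

lemma sublinear_infdist_subspace:
  fixes R :: "'z::real_normed_vector set"
  assumes R: "subspace R"
  shows "sublinear (\<lambda>x. infdist x R)" "infdist (- x) R = infdist x R"
proof -
  have ne: "R \<noteq> {}" using subspace_0[OF R] by blast
  have "sublinear (\<lambda>x. INF r\<in>R. dist x r)"
  proof (rule sublinear_INF[OF ne])
    show "bdd_below ((\<lambda>r. dist x r) ` R)" for x by (rule bdd_belowI2[of _ 0]) simp
  next
    fix k l x y assume "k \<in> R" "l \<in> R"
    then show "\<exists>m\<in>R. dist (x + y) m \<le> dist x k + dist y l"
      by (intro bexI[of _ "k + l"] dist_triangle_add) (simp add: subspace_add[OF R])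
  next
    fix c :: real and k x assume "0 < c" "k \<in> R"
    then show "\<exists>m\<in>R. dist (c *\<^sub>R x) m \<le> c * dist x k"
      by (intro bexI[of _ "c *\<^sub>R k"])
        (simp_all add: subspace_scale[OF R] dist_norm flip: scaleR_diff_right)
  qed
  then show "sublinear (\<lambda>x. infdist x R)" by (simp add: infdist_notempty[OF ne])
  have le: "infdist (- x) R \<le> infdist x R" for x
    unfolding infdist_notempty[OF ne, of x]
  proof (rule cINF_greatest[OF ne])
    fix r assume "r \<in> R"
    then show "infdist (- x) R \<le> dist x r"
      using infdist_le[OF subspace_neg[OF R], of r "- x"] by (simp add: dist_minus)
  qed
  show "infdist (- x) R = infdist x R" using le[of x] le[of "- x"] by simp
qed

lemma closed_subspace_eq_UNIV:
  fixes R :: "'z::real_normed_vector set"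
  assumes R: "subspace R" "closed R"
    and ann: "\<And>v :: 'z \<Rightarrow>\<^sub>L real. (\<And>r. r \<in> R \<Longrightarrow> blinfun_apply v r = 0) \<Longrightarrow> v = 0"
  shows "R = UNIV"
proof -
  have "z \<in> R" for z
  proof -
    have "infdist x R \<le> norm x" for x using infdist_le[OF subspace_0[OF R(1)], of x] by simp
    then obtain v :: "'z \<Rightarrow>\<^sub>L real" where v: "v z = infdist z R" "\<And>x. \<bar>v x\<bar> \<le> infdist x R"
      using norming_functional[of "\<lambda>x. infdist x R" z] sublinear_infdist_subspace[OF R(1)] by metis
    have "v = 0" using v(2) by (intro ann) (metis abs_le_zero_iff infdist_zero)
    then show ?thesis
      using v(1) in_closed_iff_infdist_zero[OF R(2)] subspace_0[OF R(1)] by (metis empty_iff zero_blinfun.rep_eq)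
  qed
  then show ?thesis by blast
qed

section \<open>Weak* continuous functionals and preadjoints\<close>

text \<open>On the real dual of \<open>'z\<close> the linear span of finitely many evaluations consists of evaluations, so this is
the fact that a functional vanishing on the common kernel of finitely many functionals is a combination of
them.\<close>

lemma evaluation_of_vanishing_on_common_kernel:
  fixes f :: "('z::real_normed_vector \<Rightarrow>\<^sub>L real) \<Rightarrow> real"
  assumes "finite F" "linear f"
    and "\<And>v. (\<And>z. z \<in> F \<Longrightarrow> blinfun_apply v z = 0) \<Longrightarrow> f v = 0"
  shows "\<exists>z. \<forall>v. f v = blinfun_apply v z"
  using assms
proof (induction F arbitrary: f rule: finite_induct)
  case empty
  then show ?case by (intro exI[of _ 0]) simp
next
  case (insert z0 F)
  show ?case
  proof (cases "\<exists>v :: 'z \<Rightarrow>\<^sub>L real. (\<forall>z\<in>F. blinfun_apply v z = 0) \<and> blinfun_apply v z0 \<noteq> 0")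
    case False
    show ?thesis
    proof (rule insert.IH[OF insert.prems(1)])
      fix v :: "'z \<Rightarrow>\<^sub>L real" assume v: "\<And>z. z \<in> F \<Longrightarrow> blinfun_apply v z = 0"
      then have "blinfun_apply v z0 = 0" using False by blast
      show "f v = 0"
      proof (rule insert.prems(2))
        fix z assume "z \<in> insert z0 F"
        then show "blinfun_apply v z = 0" using v \<open>blinfun_apply v z0 = 0\<close> by (elim insertE) simp_all
      qed
    qed
  next
    case True
    then obtain v0 :: "'z \<Rightarrow>\<^sub>L real" where v0: "\<And>z. z \<in> F \<Longrightarrow> blinfun_apply v0 z = 0" "blinfun_apply v0 z0 \<noteq> 0" by blast
    define a where "a = f v0 / blinfun_apply v0 z0"
    have "\<exists>z. \<forall>v. f v - a * blinfun_apply v z0 = blinfun_apply v z"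
    proof (rule insert.IH)
      show "linear (\<lambda>v. f v - a * blinfun_apply v z0)"
        by (intro linearI) (simp_all add: linear_add[OF insert.prems(1)]
            linear_scale[OF insert.prems(1)] blinfun.bilinear_simps algebra_simps)
      fix v :: "'z \<Rightarrow>\<^sub>L real" assume v: "\<And>z. z \<in> F \<Longrightarrow> blinfun_apply v z = 0"
      \<comment> \<open>Subtracting this multiple of \<open>v0\<close> from \<open>v\<close> puts it into the kernel of \<open>z0\<close> as well.\<close>
      let ?c = "blinfun_apply v z0 / blinfun_apply v0 z0"
      have "f (v - ?c *\<^sub>R v0) = 0"
        using v v0 by (intro insert.prems(2)) (auto simp: blinfun.bilinear_simps)
      then show "f v - a * blinfun_apply v z0 = 0"
        by (simp add: linear_diff[OF insert.prems(1)] linear_scale[OF insert.prems(1)] a_def)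
    qed
    then obtain z where "\<And>v. f v - a * blinfun_apply v z0 = blinfun_apply v z" by blast
    then show ?thesis
      by (intro exI[of _ "z + a *\<^sub>R z0"]) (simp add: blinfun.bilinear_simps algebra_simps)
  qed
qed

text \<open>On a space of functionals the strong operator topology is the topology of pointwise convergence, that is,
the weak* topology.\<close>

lemma weak_star_continuous_nhd:
  fixes g :: "('z::real_normed_vector \<Rightarrow>\<^sub>L real) \<Rightarrow> real"
  assumes g: "linear g"
    and cont: "continuous_map (subtopology strong_operator_topology (cball 0 1)) euclidean g"
    and "0 < \<epsilon>"
  obtains F where "finite F"
    "\<And>v. norm v \<le> 1 \<Longrightarrow> (\<And>z. z \<in> F \<Longrightarrow> blinfun_apply v z = 0) \<Longrightarrow> \<bar>g v\<bar> < \<epsilon>"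
proof -
  have "openin (subtopology strong_operator_topology (cball 0 1))
      {v \<in> topspace (subtopology strong_operator_topology (cball 0 1)). g v \<in> ball 0 \<epsilon>}"
    by (rule openin_continuous_map_preimage[OF cont]) simp
  then obtain W where W: "openin strong_operator_topology W"
    "{v. norm v \<le> 1 \<and> \<bar>g v\<bar> < \<epsilon>} = W \<inter> cball 0 1"
    by (auto simp: openin_subtopology strong_operator_topology_topspace dist_real_def)
  obtain U :: "('z \<Rightarrow> real) set" where U: "open U" "W = blinfun_apply -` U"
    using W(1) by (auto simp: strong_operator_topology_def openin_pullback_topology)
  have mem_W: "v \<in> W \<longleftrightarrow> \<bar>g v\<bar> < \<epsilon>" if "norm v \<le> 1" for v
  proof -
    have "v \<in> {v. norm v \<le> 1 \<and> \<bar>g v\<bar> < \<epsilon>} \<longleftrightarrow> v \<in> W \<inter> cball 0 1" by (simp only: W(2))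
    then show ?thesis using that by simp
  qed
  have "0 \<in> W" by (subst mem_W) (simp_all add: \<open>0 < \<epsilon>\<close> linear_0[OF g])
  then have "blinfun_apply 0 \<in> U" unfolding U(2) by (rule vimageD)
  then have "(\<lambda>z. 0) \<in> U" by (simp add: zero_blinfun.rep_eq)
  then obtain B where B: "(\<lambda>z::'z. 0::real) \<in> Pi\<^sub>E UNIV B" "finite {z. B z \<noteq> UNIV}" "Pi\<^sub>E UNIV B \<subseteq> U"
    using product_topology_open_contains_basis[of "\<lambda>_. euclidean" UNIV U "\<lambda>z. 0"] U(1)
    by (auto simp: open_fun_def)
  show ?thesis
  proof
    fix v :: "'z \<Rightarrow>\<^sub>L real" assume v: "norm v \<le> 1" "\<And>z. z \<in> {z. B z \<noteq> UNIV} \<Longrightarrow> blinfun_apply v z = 0"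
    have "blinfun_apply v z \<in> B z" for z
      using B(1) v(2)[of z] by (cases "B z = UNIV") (auto simp: PiE_iff)
    then have "blinfun_apply v \<in> U" using B(3) by (auto simp: PiE_iff)
    then have "v \<in> W" unfolding U(2) by (rule vimageI2)
    then show "\<bar>g v\<bar> < \<epsilon>" using mem_W[OF v(1)] by simp
  qed (rule B(2))
qed

text \<open>The functional \<open>g\<close> is of norm at most \<open>\<epsilon>\<close> on a weak* closed subspace \<open>N\<close> of finite codimension. A
Hahn-Banach extension \<open>h\<close> of its restriction to \<open>N\<close> is small everywhere, and \<open>g - h\<close> vanishes on \<open>N\<close>, so
it is an evaluation.\<close>

lemma near_evaluation_of_weak_star_continuous:
  fixes g :: "('z::real_normed_vector \<Rightarrow>\<^sub>L real) \<Rightarrow> real"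
  assumes g: "linear g"
    and cont: "continuous_map (subtopology strong_operator_topology (cball 0 1)) euclidean g"
    and "0 < \<epsilon>"
  shows "\<exists>z. \<forall>v. \<bar>g v - blinfun_apply v z\<bar> \<le> \<epsilon> * norm v"
proof -
  obtain F where F: "finite F"
    "\<And>v. norm v \<le> 1 \<Longrightarrow> (\<And>z. z \<in> F \<Longrightarrow> blinfun_apply v z = 0) \<Longrightarrow> \<bar>g v\<bar> < \<epsilon>"
    using weak_star_continuous_nhd[OF assms] by blast
  define N where "N = {v::'z \<Rightarrow>\<^sub>L real. \<forall>z\<in>F. blinfun_apply v z = 0}"
  have "subspace N" by (auto simp: N_def subspace_def blinfun.bilinear_simps)
  moreover have "g v \<le> \<epsilon> * norm v" if "v \<in> N" for v
  proof (cases "v = 0")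
    case False
    have "\<bar>g (v /\<^sub>R norm v)\<bar> < \<epsilon>"
      using that False by (intro F(2)) (auto simp: N_def blinfun.bilinear_simps)
    then have "\<bar>g v\<bar> < \<epsilon> * norm v"
      using False by (simp add: linear_scale[OF g] abs_mult field_simps)
    then show ?thesis by linarith
  qed (simp add: linear_0[OF g])
  ultimately obtain h where h: "linear h" "h \<le> (\<lambda>v. \<epsilon> * norm v)" "\<And>v. v \<in> N \<Longrightarrow> h v = g v"
    using hahn_banach_extension[of "\<lambda>v. \<epsilon> * norm v" g N] g sublinear_norm[of \<epsilon>] \<open>0 < \<epsilon>\<close>
    by (metis less_imp_le)
  have "\<exists>z. \<forall>v. g v - h v = blinfun_apply v z"
    by (rule evaluation_of_vanishing_on_common_kernel[OF F(1) linear_compose_sub[OF g h(1)]])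
      (simp add: N_def h(3))
  then obtain z where "\<And>v. g v - h v = blinfun_apply v z" by blast
  then have "h v = g v - blinfun_apply v z" for v by (simp add: algebra_simps)
  moreover have "\<bar>h v\<bar> \<le> \<epsilon> * norm v" for v
    by (rule abs_le_of_linear_le[OF h(1), of "\<lambda>v. \<epsilon> * norm v"]) (use h(2) in \<open>auto simp: le_fun_def\<close>)
  ultimately show ?thesis by metis
qed

text \<open>By the previous lemma \<open>g\<close> is a limit, in the norm of the bidual, of evaluations. The canonical map of a
Banach space into its bidual is isometric, so its range is complete and contains the limit.\<close>

theorem krein_smulian_functional:
  fixes g :: "('z::banach \<Rightarrow>\<^sub>L real) \<Rightarrow> real"
  assumes g: "linear g"
    and cont: "continuous_map (subtopology strong_operator_topology (cball 0 1)) euclidean g"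
  obtains z where "\<And>v. g v = blinfun_apply v z"
proof -
  define \<epsilon> :: "nat \<Rightarrow> real" where "\<epsilon> n = inverse (Suc n)" for n
  have "\<forall>n. \<exists>z. \<forall>v. \<bar>g v - blinfun_apply v z\<bar> \<le> \<epsilon> n * norm v"
    using near_evaluation_of_weak_star_continuous[OF assms] by (simp add: \<epsilon>_def)
  then obtain z where z: "\<And>n v. \<bar>g v - blinfun_apply v (z n)\<bar> \<le> \<epsilon> n * norm v" by metis
  have \<epsilon>: "\<epsilon> \<longlonglongrightarrow> 0" unfolding \<epsilon>_def by (rule LIMSEQ_inverse_real_of_nat)
  have dist_le: "dist (z m) (z n) \<le> \<epsilon> m + \<epsilon> n" for m n
    unfolding dist_norm
  proof (rule norm_le_of_functionals)
    fix v :: "'z \<Rightarrow>\<^sub>L real" assume "norm v \<le> 1"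
    then have "\<epsilon> m * norm v \<le> \<epsilon> m" "\<epsilon> n * norm v \<le> \<epsilon> n"
      by (simp_all add: mult_left_le \<epsilon>_def)
    then show "blinfun_apply v (z m - z n) \<le> \<epsilon> m + \<epsilon> n"
      using z[of v m] z[of v n] by (simp add: blinfun.diff_right)
  qed
  have "Cauchy z"
  proof (rule metric_CauchyI)
    fix e :: real assume "0 < e"
    then obtain M where M: "\<And>n. n \<ge> M \<Longrightarrow> \<bar>\<epsilon> n\<bar> < e / 2"
      using LIMSEQ_D[OF \<epsilon>, of "e / 2"] by auto
    then show "\<exists>M. \<forall>m\<ge>M. \<forall>n\<ge>M. dist (z m) (z n) < e"
      using dist_le by (smt (verit, best) field_sum_of_halves)
  qed
  then obtain l where l: "z \<longlonglongrightarrow> l" using Cauchy_convergent convergent_def by blast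
  show ?thesis
  proof
    fix v
    have "(\<lambda>n. g v - blinfun_apply v (z n)) \<longlonglongrightarrow> 0"
    proof (rule Lim_null_comparison)
      show "\<forall>\<^sub>F n in sequentially. norm (g v - blinfun_apply v (z n)) \<le> \<epsilon> n * norm v"
        using z by simp
      show "(\<lambda>n. \<epsilon> n * norm v) \<longlonglongrightarrow> 0" using \<epsilon> by (rule tendsto_mult_left_zero)
    qed
    moreover have "(\<lambda>n. g v - blinfun_apply v (z n)) \<longlonglongrightarrow> g v - blinfun_apply v l"
      by (intro tendsto_intros l)
    ultimately show "g v = blinfun_apply v l" using LIMSEQ_unique by fastforce
  qed
qed

lemma exists_preadjoint:
  fixes A :: "('z::banach \<Rightarrow>\<^sub>L real) \<Rightarrow> ('z \<Rightarrow>\<^sub>L real)"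
  assumes A: "bounded_linear A"
    and cont: "\<And>z. continuous_map (subtopology strong_operator_topology (cball 0 1)) euclidean
                  (\<lambda>v. blinfun_apply (A v) z)"
  obtains S :: "'z \<Rightarrow>\<^sub>L 'z" where "\<And>v. A v = v o\<^sub>L S"
proof -
  interpret A: bounded_linear A by (rule A)
  have "\<exists>y. \<forall>v. blinfun_apply (A v) z = blinfun_apply v y" for z
  proof -
    have "linear (\<lambda>v. blinfun_apply (A v) z)"
      by (intro linearI) (simp_all add: A.add A.scale blinfun.bilinear_simps)
    then show ?thesis
    proof (rule krein_smulian_functional[OF _ cont])
      fix y assume "\<And>v. blinfun_apply (A v) z = blinfun_apply v y"
      then show ?thesis by (intro exI allI)
    qed
  qed
  then obtain S where S: "\<And>v z. blinfun_apply (A v) z = blinfun_apply v (S z)" by metis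
  obtain K where K: "0 \<le> K" "\<And>v. norm (A v) \<le> norm v * K" using A.nonneg_bounded by blast
  have "bounded_linear S"
  proof (rule bounded_linear_intro)
    show "S (x + y) = S x + S y" for x y
      by (rule eq_of_functionals) (simp add: blinfun.add_right flip: S)
    show "S (c *\<^sub>R x) = c *\<^sub>R S x" for c x
      by (rule eq_of_functionals) (simp add: blinfun.scaleR_right flip: S)
    show "norm (S x) \<le> norm x * K" for x
    proof (rule norm_le_of_functionals)
      fix v :: "'z \<Rightarrow>\<^sub>L real" assume "norm v \<le> 1"
      have "blinfun_apply v (S x) \<le> norm (A v) * norm x"
        using norm_blinfun[of "A v" x] by (simp flip: S)
      also have "\<dots> \<le> K * norm x"
        using K(2)[of v] mult_right_mono[OF \<open>norm v \<le> 1\<close> K(1)] by (intro mult_right_mono) auto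
      finally show "blinfun_apply v (S x) \<le> norm x * K" by (simp add: mult.commute)
    qed
  qed
  then show ?thesis
    by (intro that[of "Blinfun S"] blinfun_eqI) (simp add: bounded_linear_Blinfun_apply S)
qed

text \<open>The first two hypotheses say that the adjoint \<open>v \<mapsto> v o\<^sub>L S\<close> is injective and has a bounded right inverse.
The second makes \<open>S\<close> bounded below, hence injective with complete range; the first makes the range dense.\<close>

lemma preadjoint_invertible:
  fixes S :: "'z::banach \<Rightarrow>\<^sub>L 'z"
  assumes inj: "\<And>v :: 'z \<Rightarrow>\<^sub>L real. v o\<^sub>L S = 0 \<Longrightarrow> v = 0"
    and lift: "\<And>v :: 'z \<Rightarrow>\<^sub>L real. \<exists>w. w o\<^sub>L S = v \<and> norm w \<le> K * norm v"
    and "0 \<le> K"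
  obtains S' where "S o\<^sub>L S' = id_blinfun" "S' o\<^sub>L S = id_blinfun" "norm S' \<le> K"
proof -
  have below: "norm z \<le> K * norm (S z)" for z
  proof (rule norm_le_of_functionals)
    fix v :: "'z \<Rightarrow>\<^sub>L real" assume "norm v \<le> 1"
    obtain w where w: "w o\<^sub>L S = v" "norm w \<le> K * norm v" using lift by blast
    then have "norm w \<le> K" using mult_left_le[OF \<open>norm v \<le> 1\<close> \<open>0 \<le> K\<close>] by simp
    have "blinfun_apply v z = blinfun_apply w (S z)" by (simp flip: w(1))
    also have "\<dots> \<le> norm w * norm (S z)" using norm_blinfun[of w "S z"] by simp
    also have "\<dots> \<le> K * norm (S z)" using \<open>norm w \<le> K\<close> by (rule mult_right_mono) simp
    finally show "blinfun_apply v z \<le> K * norm (S z)" .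
  qed
  have S_inj: "inj S"
  proof (rule injI)
    fix x y assume "S x = S y"
    then show "x = y" using below[of "x - y"] by (simp add: blinfun.diff_right)
  qed
  have "complete (range S)"
  proof (rule completeI)
    fix y assume y: "\<forall>n. y n \<in> range S" "Cauchy y"
    define x where "x n = inv S (y n)" for n
    have x: "y n = S (x n)" for n unfolding x_def using y(1) by (simp add: f_inv_into_f)
    have "Cauchy x"
    proof (rule metric_CauchyI)
      fix e :: real assume "0 < e"
      then obtain M where M: "\<And>m n. m \<ge> M \<Longrightarrow> n \<ge> M \<Longrightarrow> dist (y m) (y n) < e / (K + 1)"
        using metric_CauchyD[OF y(2), of "e / (K + 1)"] \<open>0 \<le> K\<close> by auto
      have "dist (x m) (x n) < e" if "m \<ge> M" "n \<ge> M" for m n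
      proof -
        have "dist (x m) (x n) \<le> K * dist (y m) (y n)"
          using below[of "x m - x n"] by (simp add: dist_norm x blinfun.diff_right)
        also have "\<dots> \<le> (K + 1) * dist (y m) (y n)" by (simp add: mult_right_mono)
        also have "\<dots> < e" using M[OF that] \<open>0 \<le> K\<close> by (simp add: field_simps)
        finally show ?thesis .
      qed
      then show "\<exists>M. \<forall>m\<ge>M. \<forall>n\<ge>M. dist (x m) (x n) < e" by blast
    qed
    then obtain l where "x \<longlonglongrightarrow> l" using Cauchy_convergent convergent_def by blast
    then have "y \<longlonglongrightarrow> S l" unfolding x by (intro tendsto_intros)
    then show "\<exists>l\<in>range S. y \<longlonglongrightarrow> l" by blast
  qed
  then have closed: "closed (range S)" by (rule complete_imp_closed)
  have subspace: "subspace (range S)"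
    by (intro linear_subspace_image bounded_linear.linear blinfun.bounded_linear_right subspace_UNIV)
  have surj: "range S = UNIV"
  proof (rule closed_subspace_eq_UNIV[OF subspace closed])
    fix v :: "'z \<Rightarrow>\<^sub>L real" assume "\<And>r. r \<in> range S \<Longrightarrow> blinfun_apply v r = 0"
    then have "v o\<^sub>L S = 0" by (intro blinfun_eqI) simp
    then show "v = 0" by (rule inj)
  qed
  define I where "I = inv S"
  have SI: "S (I z) = z" for z unfolding I_def by (rule surj_f_inv_f[OF surj])
  have IS: "I (S z) = z" for z unfolding I_def by (rule inv_f_f[OF S_inj])
  have bound: "norm (I z) \<le> K * norm z" for z using below[of "I z"] by (simp add: SI)
  have bl: "bounded_linear I"
  proof (rule bounded_linear_intro)
    show "I (x + y) = I x + I y" for x y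
      by (rule injD[OF S_inj]) (simp add: SI blinfun.add_right)
    show "I (c *\<^sub>R x) = c *\<^sub>R I x" for c x
      by (rule injD[OF S_inj]) (simp add: SI blinfun.scaleR_right)
  qed (use bound in \<open>simp add: mult.commute\<close>)
  show ?thesis
  proof
    show "norm (Blinfun I) \<le> K"
      using bound \<open>0 \<le> K\<close> by (intro norm_blinfun_bound) (simp_all add: bounded_linear_Blinfun_apply[OF bl])
  qed (rule blinfun_eqI, simp add: bounded_linear_Blinfun_apply[OF bl] SI IS)+
qed

section \<open>Operators of minimal norm\<close>

text \<open>Operators into the dual of \<open>'y\<close> are bounded bilinear forms on \<open>'x \<times> 'y\<close>.\<close>

lemma bilinear_blinfun:
  fixes B :: "'x::real_normed_vector \<Rightarrow> 'y::real_normed_vector \<Rightarrow> real"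
  assumes add_left: "\<And>x x' y. B (x + x') y = B x y + B x' y"
    and scale_left: "\<And>r x y. B (r *\<^sub>R x) y = r * B x y"
    and add_right: "\<And>x y y'. B x (y + y') = B x y + B x y'"
    and scale_right: "\<And>r x y. B x (r *\<^sub>R y) = r * B x y"
    and "0 \<le> c" and bound: "\<And>x y. \<bar>B x y\<bar> \<le> c * norm x * norm y"
  obtains p :: "'x \<Rightarrow>\<^sub>L 'y \<Rightarrow>\<^sub>L real"
    where "\<And>x y. blinfun_apply (blinfun_apply p x) y = B x y" "norm p \<le> c"
proof -
  have "bounded_linear (B x)" for x
    using bound[of x] add_right scale_right
    by (intro bounded_linear_intro[of _ "c * norm x"]) (simp_all add: mult_ac)
  then have app: "blinfun_apply (Blinfun (B x)) y = B x y" for x y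
    by (simp add: bounded_linear_Blinfun_apply)
  have bound': "norm (Blinfun (B x)) \<le> c * norm x" for x
    using bound \<open>0 \<le> c\<close> by (intro norm_blinfun_bound) (simp_all add: app)
  have "bounded_linear (\<lambda>x. Blinfun (B x))"
    using bound' by (intro bounded_linear_intro[of _ c] blinfun_eqI)
      (simp_all add: app blinfun.bilinear_simps add_left scale_left mult.commute)
  then have app': "blinfun_apply (Blinfun (\<lambda>x. Blinfun (B x))) x = Blinfun (B x)" for x
    by (simp add: bounded_linear_Blinfun_apply)
  have "norm (Blinfun (\<lambda>x. Blinfun (B x))) \<le> c"
    using \<open>0 \<le> c\<close> by (rule norm_blinfun_bound) (simp only: app' bound')
  then show ?thesis using that[of "Blinfun (\<lambda>x. Blinfun (B x))"] by (simp add: app app')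
qed

lemma compact_box: 
  fixes b :: "'i \<Rightarrow> real"
  shows "compact {f. \<forall>i. \<bar>f i\<bar> \<le> b i}"
proof -
  have "compactin (product_topology (\<lambda>_. euclidean) UNIV) (\<Pi>\<^sub>E i\<in>UNIV. {- b i..b i})"
    by (subst compactin_PiE) simp
  moreover have "(\<Pi>\<^sub>E i\<in>UNIV. {- b i..b i}) = {f. \<forall>i. \<bar>f i\<bar> \<le> b i}"
    by (auto simp: PiE_iff abs_le_iff) (metis minus_le_iff)+
  ultimately show ?thesis by (simp add: euclidean_product_topology)
qed

text \<open>The bilinear forms in \<open>K\<close> of norm at most \<open>c\<close> form a compact set for pointwise convergence, since they are a
closed subset of a product of intervals. These sets are nonempty for every \<open>c\<close> above the infimum \<open>m\<close> of the
norms, so their intersection is nonempty as well, and it consists of forms of norm at most \<open>m\<close>.\<close>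

theorem minimal_norm_attained:
  fixes C :: "('x::real_normed_vector \<Rightarrow>\<^sub>L 'y::real_normed_vector \<Rightarrow>\<^sub>L real) set"
  assumes "C \<noteq> {}"
    and K: "closed K" "C = {p. (\<lambda>(x, y). blinfun_apply (blinfun_apply p x) y) \<in> K}"
  obtains p where "p \<in> C" "\<And>q. q \<in> C \<Longrightarrow> norm p \<le> norm q"
proof -
  define m where "m = (INF p\<in>C. norm p)"
  have bdd: "bdd_below (norm ` C)" by (rule bdd_belowI2[of _ 0]) simp
  have m_le: "m \<le> norm q" if "q \<in> C" for q
    unfolding m_def using bdd that by (rule cINF_lower)
  have "0 \<le> m" unfolding m_def using \<open>C \<noteq> {}\<close> by (rule cINF_greatest) simp
  define L where "L = {F::'x \<times> 'y \<Rightarrow> real.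
    (\<forall>x x' y. F (x + x', y) = F (x, y) + F (x', y)) \<and> (\<forall>r x y. F (r *\<^sub>R x, y) = r * F (x, y)) \<and>
    (\<forall>x y y'. F (x, y + y') = F (x, y) + F (x, y')) \<and> (\<forall>r x y. F (x, r *\<^sub>R y) = r * F (x, y))}"
  have "closed L"
    unfolding L_def
    by (intro closed_Collect_conj closed_Collect_all closed_Collect_eq continuous_intros
        continuous_on_product_coordinates)
  define E where "E c = {F::'x \<times> 'y \<Rightarrow> real. \<forall>i. \<bar>F i\<bar> \<le> c * norm (fst i) * norm (snd i)}" for c
  have compact_E: "compact (E c)" for c unfolding E_def by (rule compact_box)
  \<comment> \<open>The set for \<open>c = m + 1\<close> provides the compactness; any \<open>c > m\<close> would do.\<close>
  have "E (m + 1) \<inter> (\<Inter>c\<in>{m<..}. E c \<inter> (K \<inter> L)) \<noteq> {}"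
  proof (rule compact_imp_fip_image[OF compact_E])
    show "closed (E c \<inter> (K \<inter> L))" for c
      unfolding E_def
      by (intro closed_Int K(1) \<open>closed L\<close> closed_Collect_all closed_Collect_le continuous_intros
        continuous_on_product_coordinates)
    fix I assume I: "finite I" "I \<subseteq> {m<..}"
    define c where "c = Min (insert (m + 1) I)"
    have c: "m < c" "c \<le> m + 1" "\<And>i. i \<in> I \<Longrightarrow> c \<le> i"
      using I by (auto simp: c_def)
    then obtain q where q: "q \<in> C" "norm q < c"
      using \<open>C \<noteq> {}\<close> bdd by (auto simp: m_def cINF_less_iff)
    let ?F = "\<lambda>(x, y). blinfun_apply (blinfun_apply q x) y"
    have "?F \<in> K" using q(1) K(2) by simp
    moreover have "?F \<in> L" by (simp add: L_def blinfun.bilinear_simps)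
    moreover have "?F \<in> E d" if "c \<le> d" for d
      unfolding E_def
    proof (intro CollectI allI)
      fix i :: "'x \<times> 'y"
      have "norm (blinfun_apply (blinfun_apply q (fst i)) (snd i))
          \<le> norm (blinfun_apply q (fst i)) * norm (snd i)" by (rule norm_blinfun)
      also have "\<dots> \<le> (norm q * norm (fst i)) * norm (snd i)"
        by (intro mult_right_mono norm_blinfun) simp
      also have "\<dots> \<le> (d * norm (fst i)) * norm (snd i)"
        using q(2) that by (intro mult_right_mono) auto
      finally show "\<bar>?F i\<bar> \<le> d * norm (fst i) * norm (snd i)" by (simp add: case_prod_beta)
    qed
    ultimately have "?F \<in> E (m + 1) \<inter> (\<Inter>d\<in>I. E d \<inter> (K \<inter> L))" using c by blast
    then show "E (m + 1) \<inter> (\<Inter>d\<in>I. E d \<inter> (K \<inter> L)) \<noteq> {}" by blast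
  qed
  then obtain F where F: "\<And>c. m < c \<Longrightarrow> F \<in> E c" "F \<in> K" "F \<in> L"
    by (auto dest: spec[of _ "m + 1"])
  have bound: "\<bar>F (x, y)\<bar> \<le> m * norm x * norm y" for x y
  proof (cases "norm x * norm y = 0")
    case True
    have "\<bar>F (x, y)\<bar> \<le> (m + 1) * (norm x * norm y)"
      using F(1)[of "m + 1"] by (simp add: E_def mult.assoc)
    also have "\<dots> = m * norm x * norm y" unfolding True mult.assoc by simp
    finally show ?thesis .
  next
    case False
    then have pos: "0 < norm x * norm y" by (simp add: less_le)
    have "\<bar>F (x, y)\<bar> / (norm x * norm y) \<le> m"
    proof (rule dense_ge)
      fix c assume "m < c"
      then have "\<bar>F (x, y)\<bar> \<le> c * norm x * norm y" using F(1)[of c] by (simp add: E_def)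
      then show "\<bar>F (x, y)\<bar> / (norm x * norm y) \<le> c" using pos by (simp add: pos_divide_le_eq mult.assoc)
    qed
    then show ?thesis using pos by (simp add: pos_divide_le_eq mult.assoc)
  qed
  obtain p :: "'x \<Rightarrow>\<^sub>L 'y \<Rightarrow>\<^sub>L real"
    where p: "\<And>x y. blinfun_apply (blinfun_apply p x) y = F (x, y)" "norm p \<le> m"
    using bilinear_blinfun[of "curry F" m] F(3) bound \<open>0 \<le> m\<close> unfolding L_def by auto
  have "p \<in> C" using F(2) K(2) p(1) by (simp add: case_prod_unfold)
  then show ?thesis using that p(2) m_le order_trans by blast
qed

section \<open>Averaging over an amenable semigroup\<close>

lemma abs_mean_le_norm:
  assumes "is_mean W \<phi>" "f \<in> W"
  shows "\<bar>\<phi> f\<bar> \<le> norm f"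
proof -
  have bound: "\<bar>apply_bcontfun f x\<bar> \<le> norm f" for x using norm_bounded[of f x] by simp
  have "\<phi> f \<le> Sup (range (apply_bcontfun f))" "Inf (range (apply_bcontfun f)) \<le> \<phi> f"
    using assms by (auto simp: is_mean_def)
  moreover have "Sup (range (apply_bcontfun f)) \<le> norm f"
    using bound by (intro cSUP_least) (auto simp: abs_le_iff)
  moreover have "- norm f \<le> Inf (range (apply_bcontfun f))"
    using bound by (intro cINF_greatest) (auto simp: abs_le_iff minus_le_iff)
  ultimately show ?thesis by linarith
qed

lemma mean_bounded_functional:
  assumes "is_mean W \<phi>"
  shows "\<phi> \<in> bounded_functionals_on W"
  using assms abs_mean_le_norm[OF assms]
  by (auto simp: bounded_functionals_on_def is_mean_def intro!: exI[of _ 1])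

text \<open>The embedding \<open>D\<close> identifies the dual of \<open>'z\<close> with an invariant subspace, on which \<open>T s\<close> acts as the adjoint
of \<open>S s\<close> and is invertible, with inverse the adjoint of \<open>S' s\<close>. If \<open>D \<circ> q\<close> is a projection onto that
subspace, then \<open>q (T s x) o\<^sub>L S' s\<close> represents its conjugate \<open>(T s)\<inverse> D q (T s)\<close> at \<open>x\<close>.\<close>

locale averaging =
  fixes T :: "'s::{semigroup_mult,topological_space} \<Rightarrow> 'x::real_normed_vector \<Rightarrow>\<^sub>L 'x"
    and D :: "('z::real_normed_vector \<Rightarrow>\<^sub>L real) \<Rightarrow>\<^sub>L 'x"
    and S S' :: "'s \<Rightarrow> 'z \<Rightarrow>\<^sub>L 'z"
    and q :: "'x \<Rightarrow>\<^sub>L 'z \<Rightarrow>\<^sub>L real"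
    and M :: real
  assumes T_mult: "T (s * t) = T s o\<^sub>L T t"
    and norm_D: "norm (blinfun_apply D v) = norm v"
    and T_D: "blinfun_apply (T s) (blinfun_apply D v) = blinfun_apply D (v o\<^sub>L S s)"
    and S_S': "S s o\<^sub>L S' s = id_blinfun" and S'_S: "S' s o\<^sub>L S s = id_blinfun"
    and S'_locally_bounded: "\<exists>U K. open U \<and> s \<in> U \<and> (\<forall>t\<in>U. norm (S' t) \<le> K)"
    and T_continuous: "continuous_on UNIV (\<lambda>s. blinfun_apply (T s) x)"
    and conjugates_bounded: "norm (blinfun_apply q (blinfun_apply (T s) x) o\<^sub>L S' s) \<le> M * norm x"
begin

lemma S_S'_apply [simp]: "blinfun_apply (S s) (blinfun_apply (S' s) z) = z"
  using arg_cong[OF S_S', of "\<lambda>f. blinfun_apply f z"] by simp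

lemma S'_S_apply [simp]: "blinfun_apply (S' s) (blinfun_apply (S s) z) = z"
  using arg_cong[OF S'_S, of "\<lambda>f. blinfun_apply f z"] by simp

lemma dist_D: "dist (blinfun_apply D v) (blinfun_apply D w) = dist v w"
  using norm_D[of "v - w"] by (simp add: dist_norm blinfun.diff_right)

text \<open>Adjoints reverse products; the order is the one that \<open>coefficient_shift\<close> needs.\<close>

lemma S_mult: "blinfun_apply (S (s * t)) z = blinfun_apply (S t) (blinfun_apply (S s) z)"
proof (rule eq_of_functionals)
  fix v :: "'z \<Rightarrow>\<^sub>L real"
  have "blinfun_apply D (v o\<^sub>L S (s * t)) = blinfun_apply D (v o\<^sub>L S t o\<^sub>L S s)"
    using T_D[of "s * t" v] by (simp add: T_mult T_D)
  then have "v o\<^sub>L S (s * t) = v o\<^sub>L S t o\<^sub>L S s"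
    using dist_D[of "v o\<^sub>L S (s * t)" "v o\<^sub>L S t o\<^sub>L S s"] by simp
  then have "blinfun_apply (v o\<^sub>L S (s * t)) z = blinfun_apply (v o\<^sub>L S t o\<^sub>L S s) z" by simp
  then show "blinfun_apply v (blinfun_apply (S (s * t)) z)
      = blinfun_apply v (blinfun_apply (S t) (blinfun_apply (S s) z))" by simp
qed

lemma S'_mult: "blinfun_apply (S' (s * t)) z = blinfun_apply (S' s) (blinfun_apply (S' t) z)"
proof -
  have "blinfun_apply (S' (s * t)) (blinfun_apply (S (s * t)) (blinfun_apply (S' s) (blinfun_apply (S' t) z)))
      = blinfun_apply (S' (s * t)) z"
    by (simp only: S_mult S_S'_apply)
  then show ?thesis by simp
qed

lemma tendsto_zero_compose_S':
  fixes u :: "'s \<Rightarrow> 'z \<Rightarrow>\<^sub>L real"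
  assumes "(u \<longlongrightarrow> 0) (at s)"
  shows "((\<lambda>t. u t o\<^sub>L S' t) \<longlongrightarrow> 0) (at s)"
proof -
  obtain U K where U: "open U" "s \<in> U" "\<And>t. t \<in> U \<Longrightarrow> norm (S' t) \<le> K"
    using S'_locally_bounded[of s] by blast
  show ?thesis
  proof (rule Lim_null_comparison)
    have "\<forall>\<^sub>F t in at s. t \<in> U" using U(1,2) by (auto simp: eventually_at_topological)
    then show "\<forall>\<^sub>F t in at s. norm (u t o\<^sub>L S' t) \<le> norm (u t) * K"
    proof eventually_elim
      case (elim t)
      have "norm (u t o\<^sub>L S' t) \<le> norm (u t) * norm (S' t)" by (rule norm_blinfun_compose)
      also have "\<dots> \<le> norm (u t) * K" using U(3)[OF elim] by (rule mult_left_mono) simp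
      finally show ?case .
    qed
    show "((\<lambda>t. norm (u t) * K) \<longlongrightarrow> 0) (at s)"
      using assms by (intro tendsto_mult_left_zero tendsto_norm_zero)
  qed
qed

text \<open>The adjoint of \<open>S s\<close> is a restriction of \<open>T s\<close>, so it inherits strong continuity.\<close>

lemma continuous_compose_S:
  fixes v :: "'z \<Rightarrow>\<^sub>L real"
  shows "continuous_on UNIV (\<lambda>s. v o\<^sub>L S s)"
proof -
  have "continuous_on UNIV (\<lambda>s. blinfun_apply D (v o\<^sub>L S s))"
    using T_continuous[of "blinfun_apply D v"] by (simp add: T_D)
  then show ?thesis
    by (simp add: continuous_on_def tendsto_iff dist_D)
qed

text \<open>Inversion preserves strong continuity where the inverses are locally bounded: with \<open>w = u s o\<^sub>L S' s\<close> the
difference \<open>(u t o\<^sub>L S' t) - w\<close> equals \<open>(u t - (w o\<^sub>L S t)) o\<^sub>L S' t\<close>, where the first factor tends to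
\<open>u s - (w o\<^sub>L S s) = 0\<close>.\<close>

lemma continuous_compose_S':
  assumes u: "continuous_on UNIV (u :: 's \<Rightarrow> 'z \<Rightarrow>\<^sub>L real)"
  shows "continuous_on UNIV (\<lambda>t. u t o\<^sub>L S' t)"
  unfolding continuous_on_def
proof
  fix s
  let ?w = "u s o\<^sub>L S' s"
  have "(u \<longlongrightarrow> u s) (at s)" "((\<lambda>t. ?w o\<^sub>L S t) \<longlongrightarrow> (?w o\<^sub>L S s)) (at s)"
    using u continuous_compose_S[of ?w] by (auto simp: continuous_on_def)
  then have lim: "((\<lambda>t. (u t - u s) + (u s - (?w o\<^sub>L S t))) \<longlongrightarrow> (u s - u s) + (u s - (?w o\<^sub>L S s))) (at s)"
    by (rule tendsto_add[OF tendsto_diff[OF _ tendsto_const] tendsto_diff[OF tendsto_const]])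
  moreover have "?w o\<^sub>L S s = u s" by (rule blinfun_eqI) simp
  ultimately have "((\<lambda>t. (u t - (?w o\<^sub>L S t)) o\<^sub>L S' t) \<longlongrightarrow> 0) (at s)"
    using lim by (intro tendsto_zero_compose_S') simp
  moreover have "(u t - (?w o\<^sub>L S t)) o\<^sub>L S' t = (u t o\<^sub>L S' t) - ?w" for t
    by (rule blinfun_eqI) (simp add: blinfun.diff_left)
  ultimately show "((\<lambda>t. u t o\<^sub>L S' t) \<longlongrightarrow> ?w) (at s within UNIV)"
    by (simp add: Lim_null[of _ ?w])
qed

definition coefficient :: "'x \<Rightarrow> 'z \<Rightarrow> 's \<Rightarrow>\<^sub>C real" where
  "coefficient x z =
     Bcontfun (\<lambda>t. blinfun_apply (blinfun_apply q (blinfun_apply (T t) x)) (blinfun_apply (S' t) z))"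

lemma conjugate_bound:
  "\<bar>blinfun_apply (blinfun_apply q (blinfun_apply (T t) x)) (blinfun_apply (S' t) z)\<bar> \<le> norm x * norm z * M"
proof -
  let ?R = "blinfun_apply q (blinfun_apply (T t) x) o\<^sub>L S' t"
  have "\<bar>blinfun_apply ?R z\<bar> \<le> norm ?R * norm z" using norm_blinfun[of ?R z] by simp
  also have "\<dots> \<le> (M * norm x) * norm z" by (intro mult_right_mono conjugates_bounded) simp
  finally show ?thesis by (simp add: mult_ac)
qed

lemma coefficient_apply:
  "apply_bcontfun (coefficient x z) t
     = blinfun_apply (blinfun_apply q (blinfun_apply (T t) x)) (blinfun_apply (S' t) z)"
proof -
  let ?f = "\<lambda>t. blinfun_apply (blinfun_apply q (blinfun_apply (T t) x)) (blinfun_apply (S' t) z)"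
  have "continuous_on UNIV (\<lambda>t. blinfun_apply (blinfun_apply q (blinfun_apply (T t) x) o\<^sub>L S' t) z)"
    by (intro continuous_intros continuous_compose_S' T_continuous)
  then have "?f \<in> bcontfun"
    using conjugate_bound by (auto simp: bcontfun_def bounded_iff)
  then show ?thesis by (simp add: coefficient_def Bcontfun_inverse)
qed

lemma bounded_bilinear_coefficient: "bounded_bilinear coefficient"
proof
  show "\<exists>K. \<forall>x z. norm (coefficient x z) \<le> norm x * norm z * K"
    using conjugate_bound by (intro exI allI norm_bound) (simp add: coefficient_apply)
qed (rule bcontfun_eqI, simp add: coefficient_apply blinfun.bilinear_simps)+

text \<open>This identity turns translation of functions into the action of the semigroup on \<open>(x, z)\<close>, and with it
invariance of a mean into equivariance of the average.\<close>

lemma coefficient_shift: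
  "apply_bcontfun (coefficient x z) (t * s)
     = apply_bcontfun (coefficient (blinfun_apply (T s) x) (blinfun_apply (S' s) z)) t"
  by (simp add: coefficient_apply T_mult S'_mult)

lemma coefficient_mem_C_r: "coefficient x z \<in> C_r"
  by (simp add: C_r_def coefficient_shift)

lemma right_translate_coefficient:
  "right_translate s (coefficient x z) = coefficient (blinfun_apply (T s) x) (blinfun_apply (S' s) z)"
  by (rule bcontfun_eqI) (simp add: apply_right_translate coefficient_mem_C_r coefficient_shift)

text \<open>Translating by \<open>s * t\<close> is translating the coefficient of \<open>(T t x, S' t z)\<close> by \<open>s\<close>, so the second family of
continuity conditions is an instance of the first.\<close>

lemma coefficient_mem_C_orbit_continuous:
  assumes "\<And>x z. continuous_map euclidean \<tau>
    (\<lambda>s. coefficient (blinfun_apply (T s) x) (blinfun_apply (S' s) z))"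
  shows "coefficient x z \<in> C_orbit_continuous \<tau>"
  using assms
  by (simp add: C_orbit_continuous_def coefficient_mem_C_r right_translate_coefficient T_mult S'_mult)

text \<open>The operator \<open>p\<close> is the integral of the conjugates of the projection against \<open>\<psi>\<close>, in the weak* sense.\<close>

lemma functional_of_coefficient:
  assumes "\<psi> \<in> bounded_functionals_on W" "\<And>x z. coefficient x z \<in> W"
  obtains p :: "'x \<Rightarrow>\<^sub>L 'z \<Rightarrow>\<^sub>L real"
    where "\<And>x z. blinfun_apply (blinfun_apply p x) z = \<psi> (coefficient x z)"
proof -
  interpret c: bounded_bilinear coefficient by (rule bounded_bilinear_coefficient)
  obtain B where \<psi>: "\<And>f g. f \<in> W \<Longrightarrow> g \<in> W \<Longrightarrow> \<psi> (f + g) = \<psi> f + \<psi> g"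
    "\<And>r f. f \<in> W \<Longrightarrow> \<psi> (r *\<^sub>R f) = r * \<psi> f" "\<And>f. f \<in> W \<Longrightarrow> \<bar>\<psi> f\<bar> \<le> B * norm f"
    using assms(1) unfolding bounded_functionals_on_def by blast
  obtain K where K: "0 \<le> K" "\<And>x z. norm (coefficient x z) \<le> norm x * norm z * K"
    using c.nonneg_bounded by blast
  have "\<bar>\<psi> (coefficient x z)\<bar> \<le> (\<bar>B\<bar> * K) * norm x * norm z" for x z
  proof -
    have "\<bar>\<psi> (coefficient x z)\<bar> \<le> \<bar>B\<bar> * norm (coefficient x z)"
      using \<psi>(3)[OF assms(2)] mult_right_mono[OF abs_ge_self, of "norm (coefficient x z)" B]
      by (meson norm_ge_zero order_trans)
    also have "\<dots> \<le> \<bar>B\<bar> * (norm x * norm z * K)" using K(2) by (rule mult_left_mono) simp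
    finally show ?thesis by (simp add: mult_ac)
  qed
  then show ?thesis
  proof (rule bilinear_blinfun[rotated 5])
    show "0 \<le> \<bar>B\<bar> * K" using K(1) by simp
  qed (rule that, simp_all add: c.add_left c.add_right c.scaleR_left c.scaleR_right \<psi>(1,2) assms(2))
qed

text \<open>Against a bounded functional \<open>\<psi>\<close> the orbit becomes \<open>s \<mapsto> (p (T s x) o\<^sub>L S' s) z\<close>, where \<open>p\<close> does not depend
on \<open>s\<close>. Here \<open>p (T s x)\<close> is norm continuous in \<open>s\<close>, so \<open>continuous_compose_S'\<close> applies; no
continuity of \<open>s \<mapsto> S' s z\<close> itself is available.\<close>

lemma coefficient_mem_C_weak: "coefficient x z \<in> C_weak"
  unfolding C_weak_def
proof (rule coefficient_mem_C_orbit_continuous)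
  fix x z
  let ?f = "\<lambda>s. coefficient (blinfun_apply (T s) x) (blinfun_apply (S' s) z)"
  show "continuous_map euclidean (weak_topology_on C_r) ?f"
    unfolding weak_topology_on_def
  proof (rule continuous_on_generated_topo)
    fix V :: "('s \<Rightarrow>\<^sub>C real) set"
    assume "V \<in> {{f \<in> C_r. \<psi> f \<in> U} |\<psi> U. \<psi> \<in> bounded_functionals_on C_r \<and> open U}"
    then obtain \<psi> :: "('s \<Rightarrow>\<^sub>C real) \<Rightarrow> real" and U
      where V: "V = {f \<in> C_r. \<psi> f \<in> U}" "\<psi> \<in> bounded_functionals_on C_r" "open U" by blast
    obtain p :: "'x \<Rightarrow>\<^sub>L 'z \<Rightarrow>\<^sub>L real"
      where p: "\<And>x z. blinfun_apply (blinfun_apply p x) z = \<psi> (coefficient x z)"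
      using functional_of_coefficient[OF V(2) coefficient_mem_C_r] by blast
    have "continuous_on UNIV (\<lambda>s. blinfun_apply (blinfun_apply p (blinfun_apply (T s) x) o\<^sub>L S' s) z)"
      by (intro continuous_intros continuous_compose_S' T_continuous)
    then have "continuous_on UNIV (\<lambda>s. \<psi> (?f s))" by (simp add: p)
    then have "open ((\<lambda>s. \<psi> (?f s)) -` U)" using V(3) by (simp add: open_vimage)
    moreover have "?f -` V = (\<lambda>s. \<psi> (?f s)) -` U" using V(1) coefficient_mem_C_r by auto
    ultimately show "openin euclidean (?f -` V \<inter> topspace euclidean)" by simp
  next
    have "(\<lambda>_. 0) \<in> bounded_functionals_on (C_r :: ('s \<Rightarrow>\<^sub>C real) set)"
      by (auto simp: bounded_functionals_on_def intro: exI[of _ 0])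
    then have "C_r \<in> {{f \<in> C_r. \<psi> f \<in> U} |\<psi> U.
        \<psi> \<in> bounded_functionals_on (C_r :: ('s \<Rightarrow>\<^sub>C real) set) \<and> open U}"
      by (intro CollectI exI[of _ "\<lambda>_. 0"] exI[of _ UNIV]) simp
    then show "?f ` topspace euclidean \<subseteq> \<Union> {{f \<in> C_r. \<psi> f \<in> U} |\<psi> U.
        \<psi> \<in> bounded_functionals_on C_r \<and> open U}"
      using coefficient_mem_C_r by blast
  qed
qed

text \<open>Norm continuity, unlike strong continuity, passes from the adjoints to \<open>S\<close>, as
\<open>\<parallel>S s - S t\<parallel> \<le> \<parallel>T s - T t\<parallel>\<close>; the inverses follow from \<open>S' t - S' s = S' t (S s - S t) S' s\<close>.\<close>

lemma S'_continuous:
  assumes T: "continuous_on UNIV T"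
  shows "continuous_on UNIV (\<lambda>s. blinfun_apply (S' s) z)"
  unfolding continuous_on_def
proof
  fix s
  have S_le: "norm (blinfun_apply (S s) y - blinfun_apply (S t) y) \<le> norm (T s - T t) * norm y" for t y
  proof (rule norm_le_of_functionals)
    fix v :: "'z \<Rightarrow>\<^sub>L real" assume v: "norm v \<le> 1"
    have "norm ((v o\<^sub>L S s) - (v o\<^sub>L S t)) = norm (blinfun_apply (T s - T t) (blinfun_apply D v))"
      by (simp add: blinfun.diff_left T_D norm_D flip: blinfun.diff_right)
    also have "\<dots> \<le> norm (T s - T t) * norm v"
      using norm_blinfun[of "T s - T t" "blinfun_apply D v"] by (simp add: norm_D)
    also have "\<dots> \<le> norm (T s - T t)" using v by (simp add: mult_left_le)
    finally have "norm ((v o\<^sub>L S s) - (v o\<^sub>L S t)) \<le> norm (T s - T t)" .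
    then have "norm ((v o\<^sub>L S s) - (v o\<^sub>L S t)) * norm y \<le> norm (T s - T t) * norm y"
      by (rule mult_right_mono) simp
    moreover have "blinfun_apply v (blinfun_apply (S s) y - blinfun_apply (S t) y)
        = blinfun_apply ((v o\<^sub>L S s) - (v o\<^sub>L S t)) y" by (simp add: blinfun.bilinear_simps)
    ultimately show "blinfun_apply v (blinfun_apply (S s) y - blinfun_apply (S t) y)
        \<le> norm (T s - T t) * norm y"
      using norm_blinfun[of "(v o\<^sub>L S s) - (v o\<^sub>L S t)" y] by simp
  qed
  obtain U K where U: "open U" "s \<in> U" "\<And>t. t \<in> U \<Longrightarrow> norm (S' t) \<le> K"
    using S'_locally_bounded[of s] by blast
  let ?y = "blinfun_apply (S' s) z"
  have "((\<lambda>t. blinfun_apply (S' t) z - ?y) \<longlongrightarrow> 0) (at s)"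
  proof (rule Lim_null_comparison)
    have "\<forall>\<^sub>F t in at s. t \<in> U" using U(1,2) by (auto simp: eventually_at_topological)
    then show "\<forall>\<^sub>F t in at s. norm (blinfun_apply (S' t) z - ?y) \<le> norm (T s - T t) * (norm ?y * K)"
    proof eventually_elim
      case (elim t)
      have "0 \<le> K" using U(3)[OF elim] norm_ge_zero[of "S' t"] by linarith
      have "blinfun_apply (S' t) z - ?y
          = blinfun_apply (S' t) (blinfun_apply (S s) ?y - blinfun_apply (S t) ?y)"
        by (simp add: blinfun.diff_right)
      also have "norm \<dots> \<le> norm (S' t) * norm (blinfun_apply (S s) ?y - blinfun_apply (S t) ?y)"
        by (rule norm_blinfun)
      also have "\<dots> \<le> K * (norm (T s - T t) * norm ?y)"
        using U(3)[OF elim] S_le \<open>0 \<le> K\<close> by (rule mult_mono) simp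
      finally show ?case by (simp add: mult_ac)
    qed
    have "((\<lambda>t. T s - T t) \<longlongrightarrow> T s - T s) (at s)"
      using T by (intro tendsto_intros) (simp add: continuous_on_def)
    then show "((\<lambda>t. norm (T s - T t) * (norm ?y * K)) \<longlongrightarrow> 0) (at s)"
      by (intro tendsto_mult_left_zero tendsto_norm_zero) simp
  qed
  then show "((\<lambda>t. blinfun_apply (S' t) z) \<longlongrightarrow> ?y) (at s within UNIV)"
    by (simp add: Lim_null[of _ ?y])
qed

lemma coefficient_mem_C_norm:
  assumes "continuous_on UNIV T"
  shows "coefficient x z \<in> C_norm"
  unfolding C_norm_def
proof (rule coefficient_mem_C_orbit_continuous)
  fix x z
  have "continuous_on UNIV (\<lambda>s. coefficient (blinfun_apply (T s) x) (blinfun_apply (S' s) z))"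
    by (intro bounded_bilinear.continuous_on[OF bounded_bilinear_coefficient] T_continuous
        S'_continuous assms)
  then show "continuous_map euclidean (top_of_set C_r)
      (\<lambda>s. coefficient (blinfun_apply (T s) x) (blinfun_apply (S' s) z))"
    by (intro continuous_map_into_subtopology) (auto simp: coefficient_mem_C_r)
qed

text \<open>The third conclusion carries the linearity over the scalars: it is applied to \<open>\<sigma>\<close> and \<open>\<tau>\<close> the multiplications
by a scalar.\<close>

theorem equivariant_average:
  assumes amenable: "strongly_right_amenable TYPE('s)
      \<or> weakly_right_amenable TYPE('s) \<and> continuous_on UNIV T"
    and q: "\<And>v. blinfun_apply q (blinfun_apply D v) = v"
  obtains p :: "'x \<Rightarrow>\<^sub>L 'z \<Rightarrow>\<^sub>L real"
  where "\<And>v. blinfun_apply p (blinfun_apply D v) = v"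
    "\<And>s x. blinfun_apply p (blinfun_apply (T s) x) = blinfun_apply p x o\<^sub>L S s"
    "\<And>\<sigma> \<tau> x. \<lbrakk>\<And>s. T s o\<^sub>L \<sigma> = \<sigma> o\<^sub>L T s; \<And>s. S' s o\<^sub>L \<tau> = \<tau> o\<^sub>L S' s;
       \<And>x. blinfun_apply q (blinfun_apply \<sigma> x) = blinfun_apply q x o\<^sub>L \<tau>\<rbrakk>
       \<Longrightarrow> blinfun_apply p (blinfun_apply \<sigma> x) = blinfun_apply p x o\<^sub>L \<tau>"
proof -
  obtain W and \<phi> :: "('s \<Rightarrow>\<^sub>C real) \<Rightarrow> real"
    where \<phi>: "is_right_invariant_mean W \<phi>" and W: "\<And>x z. coefficient x z \<in> W"
    using amenable coefficient_mem_C_weak coefficient_mem_C_norm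
    by (metis strongly_right_amenable_def weakly_right_amenable_def)
  have mean: "is_mean W \<phi>" and inv: "\<And>f s. f \<in> W \<Longrightarrow> \<phi> (right_translate s f) = \<phi> f"
    using \<phi> by (auto simp: is_right_invariant_mean_def)
  obtain p :: "'x \<Rightarrow>\<^sub>L 'z \<Rightarrow>\<^sub>L real"
    where p: "\<And>x z. blinfun_apply (blinfun_apply p x) z = \<phi> (coefficient x z)"
    using functional_of_coefficient[OF mean_bounded_functional[OF mean] W] by blast
  show ?thesis
  proof
    fix v
    show "blinfun_apply p (blinfun_apply D v) = v"
    proof (rule blinfun_eqI)
      fix z
      have "apply_bcontfun (coefficient (blinfun_apply D v) z) = (\<lambda>_. blinfun_apply v z)"
        by (rule ext) (simp add: coefficient_apply T_D q)
      then have "range (apply_bcontfun (coefficient (blinfun_apply D v) z)) = {blinfun_apply v z}"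
        by auto
      then show "blinfun_apply (blinfun_apply p (blinfun_apply D v)) z = blinfun_apply v z"
        using mean W[of "blinfun_apply D v" z] by (fastforce simp: is_mean_def p)
    qed
  next
    fix s x
    show "blinfun_apply p (blinfun_apply (T s) x) = blinfun_apply p x o\<^sub>L S s"
    proof (rule blinfun_eqI)
      fix z
      show "blinfun_apply (blinfun_apply p (blinfun_apply (T s) x)) z
          = blinfun_apply (blinfun_apply p x o\<^sub>L S s) z"
        using inv[OF W, of s x "blinfun_apply (S s) z"] by (simp add: p right_translate_coefficient)
    qed
  next
    fix \<sigma> :: "'x \<Rightarrow>\<^sub>L 'x" and \<tau> :: "'z \<Rightarrow>\<^sub>L 'z" and x
    assume T\<sigma>: "\<And>s. T s o\<^sub>L \<sigma> = \<sigma> o\<^sub>L T s" and S'\<tau>: "\<And>s. S' s o\<^sub>L \<tau> = \<tau> o\<^sub>L S' s"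
      and q\<sigma>: "\<And>x. blinfun_apply q (blinfun_apply \<sigma> x) = blinfun_apply q x o\<^sub>L \<tau>"
    have "blinfun_apply (T s) (blinfun_apply \<sigma> x) = blinfun_apply \<sigma> (blinfun_apply (T s) x)" for s
      using arg_cong[OF T\<sigma>[of s], of "\<lambda>f. blinfun_apply f x"] by simp
    moreover have "blinfun_apply \<tau> (blinfun_apply (S' s) z) = blinfun_apply (S' s) (blinfun_apply \<tau> z)" for s z
      using arg_cong[OF S'\<tau>[of s], of "\<lambda>f. blinfun_apply f z"] by simp
    ultimately have "coefficient (blinfun_apply \<sigma> x) z = coefficient x (blinfun_apply \<tau> z)" for z
      by (intro bcontfun_eqI) (simp add: coefficient_apply q\<sigma>)
    then show "blinfun_apply p (blinfun_apply \<sigma> x) = blinfun_apply p x o\<^sub>L \<tau>"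
      by (intro blinfun_eqI) (simp add: p)
  qed
qed

end

section \<open>Reduction to real scalars\<close>

text \<open>The real inner product with \<open>1\<close> plays the role of the real part. The map that sends \<open>a\<close> to
\<open>c \<mapsto> 1 \<bullet> (c * a)\<close> is injective, since \<open>c = inverse a\<close> gives the value \<open>1\<close> for \<open>a \<noteq> 0\<close>, and a linear
injection of a finite-dimensional space into its dual is onto.\<close>

lemma real_functional_on_scalars:
  fixes L :: "'k::real_or_complex \<Rightarrow> real"
  assumes "linear L"
  shows "\<exists>a. \<forall>c. L c = 1 \<bullet> (c * a)"
proof -
  define N where "N a = adjoint (\<lambda>c. c * a) 1" for a :: 'k
  have lin: "linear (\<lambda>c::'k. c * a)" for a by (intro linearI) (simp_all add: distrib_right)
  have inner_N: "c \<bullet> N a = 1 \<bullet> (c * a)" for a c by (simp add: N_def adjoint_works[OF lin] inner_commute)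
  have "linear N"
  proof (rule linearI)
    show "N (a + b) = N a + N b" for a b
      by (rule iffD1[OF vector_eq_ldot]) (simp add: inner_N inner_add_right distrib_left)
    show "N (r *\<^sub>R a) = r *\<^sub>R N a" for r a
      by (rule iffD1[OF vector_eq_ldot]) (simp add: inner_N)
  qed
  moreover have "a = 0" if "N a = 0" for a
  proof (rule ccontr)
    assume "a \<noteq> 0"
    then show False using inner_N[of "inverse a" a] that by simp
  qed
  ultimately have "surj N"
    by (intro linear_injective_imp_surjective) (auto simp: linear_injective_0)
  then obtain a where "N a = adjoint L 1" by (metis surjD)
  then have "L c = 1 \<bullet> (c * a)" for c
    using inner_N[of c a] adjoint_works[OF assms, of c 1] by simp
  then show ?thesis by blast
qed

context banach_space_over
begin

lemma scale_scaleR: "smul c (r *\<^sub>R x) = r *\<^sub>R smul c x"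
  by (metis mult.commute scale_of_real scale_scale)

lemma bounded_linear_scale: "bounded_linear (smul c)"
  by (rule bounded_linear_intro[of _ "norm c"])
    (simp_all add: scale_right_distrib scale_scaleR norm_scale)

definition scaling :: "'k \<Rightarrow> 'a \<Rightarrow>\<^sub>L 'a" where
  "scaling c = Blinfun (smul c)"

lemma scaling_apply [simp]: "blinfun_apply (scaling c) x = smul c x"
  by (simp add: scaling_def bounded_linear_Blinfun_apply bounded_linear_scale)

definition real_part :: "('a \<Rightarrow>\<^sub>L 'k) \<Rightarrow> 'a \<Rightarrow>\<^sub>L real" where
  "real_part f = blinfun_inner_right 1 o\<^sub>L f"

lemma real_part_apply [simp]: "blinfun_apply (real_part f) z = 1 \<bullet> blinfun_apply f z"
  by (simp add: real_part_def)

text \<open>A rotation of \<open>z\<close> by a scalar of modulus \<open>1\<close> makes \<open>f z\<close> real and nonnegative without changing the norms.\<close>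

lemma norm_real_part:
  assumes f: "f \<in> dual_space smul"
  shows "norm (real_part f) = norm f"
proof (rule antisym)
  show "norm (real_part f) \<le> norm f"
  proof (rule norm_blinfun_bound)
    fix z
    have "\<bar>1 \<bullet> blinfun_apply f z\<bar> \<le> norm (blinfun_apply f z)"
      using Cauchy_Schwarz_ineq2[of "1::'k" "blinfun_apply f z"] by simp
    then show "norm (blinfun_apply (real_part f) z) \<le> norm f * norm z"
      using norm_blinfun[of f z] by simp
  qed simp
  show "norm f \<le> norm (real_part f)"
  proof (rule norm_blinfun_bound)
    fix z
    show "norm (blinfun_apply f z) \<le> norm (real_part f) * norm z"
    proof (cases "blinfun_apply f z = 0")
      case False
      let ?c = "of_real (norm (blinfun_apply f z)) * inverse (blinfun_apply f z)"
      have "blinfun_apply f (smul ?c z) = norm (blinfun_apply f z) *\<^sub>R 1"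
        using f False by (simp add: dual_space_def scaleR_conv_of_real)
      then have "norm (blinfun_apply f z) = blinfun_apply (real_part f) (smul ?c z)"
        by (simp add: dot_square_norm)
      also have "\<dots> \<le> norm (real_part f) * norm (smul ?c z)"
        using norm_blinfun[of "real_part f" "smul ?c z"] by simp
      also have "norm (smul ?c z) = norm z"
        using False by (simp add: norm_scale norm_mult norm_inverse)
      finally show ?thesis .
    qed simp
  qed simp
qed

text \<open>The value \<open>f z\<close> is determined by the real functional \<open>c \<mapsto> u (c z)\<close> on the scalars, and uniqueness of the
representing scalar makes \<open>f\<close> homogeneous.\<close>

lemma real_part_surjective:
  obtains f where "f \<in> dual_space smul" "real_part f = u"
proof -
  have "\<exists>a. \<forall>c. blinfun_apply u (smul c z) = 1 \<bullet> (c * a)" for z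
    by (rule real_functional_on_scalars, rule linearI)
      (simp_all add: scale_left_distrib blinfun.add_right blinfun.scaleR_right scale_of_real
        scaleR_conv_of_real flip: scale_scale)
  then obtain f where f: "\<And>c z. blinfun_apply u (smul c z) = 1 \<bullet> (c * f z)" by metis
  have cancel: "a = b" if "\<And>c. 1 \<bullet> (c * a) = 1 \<bullet> (c * b)" for a b :: 'k
  proof (rule ccontr)
    assume "a \<noteq> b"
    then have "inverse (a - b) * a - inverse (a - b) * b = 1" by (simp flip: right_diff_distrib)
    then have "1 \<bullet> (inverse (a - b) * a) - 1 \<bullet> (inverse (a - b) * b) = 1 \<bullet> (1::'k)"
      by (simp only: flip: inner_diff_right)
    then show False using that[of "inverse (a - b)"] by simp
  qed
  have scale: "f (smul c z) = c * f z" for c z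
  proof (rule cancel)
    show "1 \<bullet> (d * f (smul c z)) = 1 \<bullet> (d * (c * f z))" for d
      using f[of d "smul c z"] f[of "d * c" z] by (simp add: mult.assoc)
  qed
  have "bounded_linear f"
  proof (rule bounded_linear_intro)
    show "f (x + y) = f x + f y" for x y
      by (rule cancel) (simp add: distrib_left inner_add_right scale_right_distrib blinfun.add_right flip: f)
    show "f (r *\<^sub>R x) = r *\<^sub>R f x" for r x
      using scale[of "of_real r" x] by (simp add: scale_of_real scaleR_conv_of_real)
    show "norm (f x) \<le> norm x * norm u" for x
    proof (cases "f x = 0")
      case False
      let ?c = "of_real (norm (f x)) * inverse (f x)"
      have "norm (f x) = blinfun_apply u (smul ?c x)"
        using False by (simp add: f dot_square_norm flip: scaleR_conv_of_real)
      also have "\<dots> \<le> norm u * norm (smul ?c x)"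
        using norm_blinfun[of u "smul ?c x"] by simp
      also have "norm (smul ?c x) = norm x"
        using False by (simp add: norm_scale norm_mult norm_inverse)
      finally show ?thesis by (simp add: mult.commute)
    qed simp
  qed
  note app = bounded_linear_Blinfun_apply[OF this]
  show ?thesis
  proof
    show "Blinfun f \<in> dual_space smul" by (simp add: dual_space_def app scale)
    show "real_part (Blinfun f) = u"
      using f[of 1] by (intro blinfun_eqI) (simp add: app)
  qed
qed

end

locale dual_subspace =
  X: banach_space_over scaleX + Z: banach_space_over scaleZ
  for scaleX :: "'k::real_or_complex \<Rightarrow> 'a::banach \<Rightarrow> 'a"
    and scaleZ :: "'k \<Rightarrow> 'z::banach \<Rightarrow> 'z" +
  fixes Y :: "'a set" and J :: "'a \<Rightarrow> 'z \<Rightarrow>\<^sub>L 'k"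
  assumes subspace_Y: "module.subspace scaleX Y"
    and isometry: "isometry_onto_dual scaleX scaleZ Y J"
begin

lemma
  shows Y_add: "x \<in> Y \<Longrightarrow> y \<in> Y \<Longrightarrow> x + y \<in> Y"
    and Y_scale: "y \<in> Y \<Longrightarrow> scaleX c y \<in> Y"
    and Y_scaleR: "y \<in> Y \<Longrightarrow> r *\<^sub>R y \<in> Y"
  using X.subspace_add[OF subspace_Y] X.subspace_scale[OF subspace_Y]
    X.subspace_scale[OF subspace_Y, of y "of_real r"] by (simp_all add: X.scale_of_real)

lemma
  shows J_bij: "bij_betw J Y (dual_space scaleZ)"
    and J_add: "x \<in> Y \<Longrightarrow> y \<in> Y \<Longrightarrow> J (x + y) = J x + J y"
    and J_scale: "y \<in> Y \<Longrightarrow> blinfun_apply (J (scaleX c y)) z = c * blinfun_apply (J y) z"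
    and J_norm: "y \<in> Y \<Longrightarrow> norm (J y) = norm y"
  using isometry by (auto simp: isometry_onto_dual_def)

lemma J_scale': "y \<in> Y \<Longrightarrow> blinfun_apply (J y) (scaleZ c z) = c * blinfun_apply (J y) z"
  using bij_betwE[OF J_bij] by (auto simp: dual_space_def)

definition real_functional :: "'a \<Rightarrow> 'z \<Rightarrow>\<^sub>L real" where
  "real_functional y = Z.real_part (J y)"

lemma real_functional_apply: "blinfun_apply (real_functional y) z = 1 \<bullet> blinfun_apply (J y) z"
  by (simp add: real_functional_def)

lemma real_functional_add:
  "x \<in> Y \<Longrightarrow> y \<in> Y \<Longrightarrow> real_functional (x + y) = real_functional x + real_functional y"
  by (rule blinfun_eqI) (simp add: real_functional_apply J_add blinfun.bilinear_simps inner_add_right)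

lemma real_functional_scale:
  "y \<in> Y \<Longrightarrow> real_functional (scaleX c y) = real_functional y o\<^sub>L Z.scaling c"
  by (rule blinfun_eqI) (simp add: real_functional_apply J_scale J_scale')

lemma real_functional_scaleR:
  "y \<in> Y \<Longrightarrow> real_functional (r *\<^sub>R y) = r *\<^sub>R real_functional y"
  using real_functional_scale[of y "of_real r"]
  by (intro blinfun_eqI) (simp add: X.scale_of_real Z.scale_of_real blinfun.bilinear_simps)

lemma norm_real_functional: "y \<in> Y \<Longrightarrow> norm (real_functional y) = norm y"
  using bij_betwE[OF J_bij] by (simp add: real_functional_def Z.norm_real_part J_norm)

lemma real_functional_inj:
  assumes "x \<in> Y" "y \<in> Y" "real_functional x = real_functional y"
  shows "x = y"
proof -
  have "- y \<in> Y" using Y_scaleR[of y "- 1"] assms(2) by simp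
  then have "x - y \<in> Y" using Y_add[OF assms(1) \<open>- y \<in> Y\<close>] by simp
  then have "norm (x - y) = norm (real_functional (x + (- 1) *\<^sub>R y))"
    by (simp add: norm_real_functional)
  also have "real_functional (x + (- 1) *\<^sub>R y) = 0"
    using assms \<open>- y \<in> Y\<close> real_functional_scaleR[of y "- 1"] by (subst real_functional_add) auto
  finally show ?thesis by simp
qed

lemma real_functional_surj: "\<exists>y\<in>Y. real_functional y = v"
proof -
  obtain f where f: "f \<in> dual_space scaleZ" "Z.real_part f = v" by (rule Z.real_part_surjective)
  then have "f \<in> J ` Y" using bij_betw_imp_surj_on[OF J_bij] by simp
  then obtain y where "y \<in> Y" "J y = f" by blast
  with f(2) show ?thesis by (auto simp: real_functional_def)
qed

definition embedding :: "('z \<Rightarrow>\<^sub>L real) \<Rightarrow>\<^sub>L 'a" where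
  "embedding = Blinfun (\<lambda>v. SOME y. y \<in> Y \<and> real_functional y = v)"

lemma
  shows embedding_mem: "blinfun_apply embedding v \<in> Y"
    and real_functional_embedding: "real_functional (blinfun_apply embedding v) = v"
proof -
  define D where "D v = (SOME y. y \<in> Y \<and> real_functional y = v)" for v
  have D: "D v \<in> Y" "real_functional (D v) = v" for v
    using real_functional_surj[of v] unfolding D_def by (metis (mono_tags, lifting) someI_ex)+
  have "bounded_linear D"
  proof (rule bounded_linear_intro)
    show "D (v + w) = D v + D w" for v w
      by (rule real_functional_inj) (simp_all add: D Y_add real_functional_add)
    show "D (r *\<^sub>R v) = r *\<^sub>R D v" for r v
      by (rule real_functional_inj) (simp_all add: D Y_scaleR real_functional_scaleR)
    show "norm (D v) \<le> norm v * 1" for v using norm_real_functional[OF D(1), of v] by (simp add: D(2))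
  qed
  then have "blinfun_apply embedding = D"
    unfolding embedding_def D_def[symmetric] by (rule bounded_linear_Blinfun_apply)
  then show "blinfun_apply embedding v \<in> Y" "real_functional (blinfun_apply embedding v) = v"
    by (simp_all add: D)
qed

lemma embedding_real_functional: "y \<in> Y \<Longrightarrow> blinfun_apply embedding (real_functional y) = y"
  by (rule real_functional_inj) (simp_all add: embedding_mem real_functional_embedding)

lemma norm_embedding: "norm (blinfun_apply embedding v) = norm v"
  using norm_real_functional[OF embedding_mem, of v] by (simp add: real_functional_embedding)

lemma embedding_inj: "blinfun_apply embedding v = blinfun_apply embedding w \<longleftrightarrow> v = w"
  by (metis real_functional_embedding)

lemma embedding_scaling:
  "blinfun_apply embedding (v o\<^sub>L Z.scaling c) = scaleX c (blinfun_apply embedding v)"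
  by (rule real_functional_inj)
    (simp_all add: embedding_mem Y_scale real_functional_scale real_functional_embedding)

text \<open>The identification with the real dual also respects the weak* topologies: the components of \<open>J y z\<close> are
values of the real functional at scalar multiples of \<open>z\<close>.\<close>

lemma embedding_continuous:
  "continuous_map strong_operator_topology (weak_star_topology Y J) (blinfun_apply embedding)"
proof -
  have "\<exists>a. \<forall>c. c \<bullet> e = 1 \<bullet> (c * a)" for e :: 'k
    by (intro real_functional_on_scalars bounded_linear.linear bounded_linear_inner_left)
  then obtain a :: "'k \<Rightarrow> 'k" where a: "\<And>c e. c \<bullet> e = 1 \<bullet> (c * a e)" by metis
  \<comment> \<open>Recovers \<open>J y\<close> from its real part, which is the functional embedded as \<open>y\<close>.\<close>
  define G :: "('z \<Rightarrow> real) \<Rightarrow> 'z \<Rightarrow> 'k" where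
    "G g z = (\<Sum>e\<in>Basis. g (scaleZ (a e) z) *\<^sub>R e)" for g z
  have "continuous_on UNIV (\<lambda>g. G g z)" for z
    unfolding G_def
    by (intro continuous_on_sum continuous_on_scaleR continuous_on_const continuous_on_product_coordinates)
  then have "continuous_on UNIV G" by (rule continuous_on_coordinatewise_then_product)
  then have "continuous_map strong_operator_topology euclidean (G \<circ> blinfun_apply)"
    unfolding strong_operator_topology_def by (intro continuous_map_pullback) simp
  moreover have "G \<circ> blinfun_apply = (\<lambda>y. blinfun_apply (J y)) \<circ> blinfun_apply embedding"
  proof (intro ext)
    fix v z
    let ?y = "blinfun_apply embedding v"
    have v: "blinfun_apply v x = 1 \<bullet> blinfun_apply (J ?y) x" for x
      using real_functional_apply[of ?y x] by (simp add: real_functional_embedding)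
    have "blinfun_apply v (scaleZ (a e) z) = blinfun_apply (J ?y) z \<bullet> e" for e
      unfolding v J_scale'[OF embedding_mem] using a[of "blinfun_apply (J ?y) z" e]
      by (simp add: mult.commute)
    then show "(G \<circ> blinfun_apply) v z = ((\<lambda>y. blinfun_apply (J y)) \<circ> blinfun_apply embedding) v z"
      by (simp add: G_def euclidean_representation)
  qed
  ultimately show ?thesis
    unfolding weak_star_topology_def by (intro continuous_map_pullback') (auto simp: embedding_mem)
qed

lemma real_functional_continuous:
  "continuous_map (weak_star_topology Y J) euclidean (\<lambda>y. blinfun_apply (real_functional y) z)"
proof -
  have "continuous_on UNIV (\<lambda>f::'z \<Rightarrow> 'k. 1 \<bullet> f z)"
    by (intro continuous_intros continuous_on_product_coordinates)
  then have "continuous_map (weak_star_topology Y J) euclidean ((\<lambda>f. 1 \<bullet> f z) \<circ> (\<lambda>y. blinfun_apply (J y)))"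
    unfolding weak_star_topology_def
    by (intro continuous_map_pullback) simp
  then show ?thesis by (simp add: real_functional_apply comp_def)
qed

text \<open>The supremum in \<open>onorm_on\<close> carries information only when it is taken over a bounded set; the quotient at
\<open>y = 0\<close> is \<open>0\<close> and makes the supremum nonnegative even for \<open>Y = {0}\<close>.\<close>

lemma onorm_on_bound:
  assumes "\<And>y. y \<in> Y \<Longrightarrow> norm (g y) \<le> B * norm y" "g 0 = 0"
  shows "0 \<le> onorm_on Y g" "y \<in> Y \<Longrightarrow> norm (g y) \<le> onorm_on Y g * norm y"
proof -
  have "norm (g y) / norm y \<le> max B 0" if "y \<in> Y" for y
  proof (cases "y = 0")
    case False
    then show ?thesis using assms(1)[OF that] by (simp add: pos_divide_le_eq le_max_iff_disj)
  qed simp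
  then have bdd: "bdd_above ((\<lambda>y. norm (g y) / norm y) ` Y)" by (rule bdd_aboveI2)
  have "0 \<in> Y" using embedding_mem[of 0] by simp
  then show "0 \<le> onorm_on Y g"
    unfolding onorm_on_def using cSUP_upper[OF _ bdd, of 0] by simp
  show "norm (g y) \<le> onorm_on Y g * norm y" if "y \<in> Y"
  proof (cases "y = 0")
    case False
    have "norm (g y) / norm y \<le> onorm_on Y g"
      unfolding onorm_on_def using that bdd by (rule cSUP_upper)
    then show ?thesis using False by (simp add: pos_divide_le_eq)
  qed (simp add: assms(2))
qed

text \<open>Through the embedding the restriction of \<open>T\<close> becomes an operator \<open>A\<close> on the real dual that is weak*
continuous on the unit ball, and the inverse of the restriction supplies the right inverse and the bound
that \<open>preadjoint_invertible\<close> asks for.\<close>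

lemma restriction_preadjoint:
  fixes T :: "'a \<Rightarrow>\<^sub>L 'a"
  assumes image: "blinfun_apply T ` Y = Y" and iso: "restricts_to_isomorphism Y T"
    and cont: "continuous_map (subtopology (weak_star_topology Y J) (Y \<inter> cball 0 1))
                 (weak_star_topology Y J) (blinfun_apply T)"
  obtains S S' where
    "\<And>v. blinfun_apply T (blinfun_apply embedding v) = blinfun_apply embedding (v o\<^sub>L S)"
    "S o\<^sub>L S' = id_blinfun" "S' o\<^sub>L S = id_blinfun"
    "norm S' \<le> onorm_on Y (restriction_inverse Y T)"
proof -
  have T_mem: "blinfun_apply T y \<in> Y" if "y \<in> Y" for y using image that by blast
  define A where "A v = real_functional (blinfun_apply T (blinfun_apply embedding v))" for v
  have D_A: "blinfun_apply embedding (A v) = blinfun_apply T (blinfun_apply embedding v)" for v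
    unfolding A_def by (rule embedding_real_functional) (simp add: T_mem embedding_mem)
  have "bounded_linear A"
  proof (rule bounded_linear_intro)
    show "A (v + w) = A v + A w" for v w
      by (rule embedding_inj[THEN iffD1]) (simp add: D_A blinfun.add_right)
    show "A (r *\<^sub>R v) = r *\<^sub>R A v" for r v
      by (rule embedding_inj[THEN iffD1]) (simp add: D_A blinfun.scaleR_right)
    show "norm (A v) \<le> norm v * norm T" for v
      using norm_blinfun[of T "blinfun_apply embedding v"]
      by (simp add: norm_embedding mult.commute flip: D_A)
  qed
  moreover have "continuous_map (subtopology strong_operator_topology (cball 0 1)) euclidean
      (\<lambda>v. blinfun_apply (A v) z)" for z
  proof -
    have "continuous_map (subtopology strong_operator_topology (cball 0 1))
        (subtopology (weak_star_topology Y J) (Y \<inter> cball 0 1)) (blinfun_apply embedding)"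
      by (intro continuous_map_into_subtopology continuous_map_from_subtopology embedding_continuous)
        (auto simp: embedding_mem norm_embedding)
    from continuous_map_compose[OF continuous_map_compose[OF this cont] real_functional_continuous]
    show ?thesis by (simp add: comp_def A_def)
  qed
  ultimately obtain S :: "'z \<Rightarrow>\<^sub>L 'z" where S: "\<And>v. A v = v o\<^sub>L S" using exists_preadjoint by blast
  have T_D: "blinfun_apply T (blinfun_apply embedding v) = blinfun_apply embedding (v o\<^sub>L S)" for v
    using D_A[of v] by (simp add: S)
  let ?I = "restriction_inverse Y T"
  obtain B where bij: "bij_betw (blinfun_apply T) Y Y" and B: "\<And>y. y \<in> Y \<Longrightarrow> norm (?I y) \<le> B * norm y"
    using iso by (auto simp: restricts_to_isomorphism_def)
  have I: "?I y \<in> Y" "blinfun_apply T (?I y) = y" if "y \<in> Y" for y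
    using that image by (auto simp: restriction_inverse_def inv_into_into f_inv_into_f)
  have "0 \<in> Y" using embedding_mem[of 0] by simp
  then have "?I 0 = 0" using B[of 0] by simp
  note onorm = onorm_on_bound[of ?I, OF B this]
  have lift: "\<exists>w. w o\<^sub>L S = v \<and> norm w \<le> onorm_on Y ?I * norm v" for v :: "'z \<Rightarrow>\<^sub>L real"
  proof (intro exI conjI)
    let ?y = "?I (blinfun_apply embedding v)"
    have y: "?y \<in> Y" by (rule I(1)[OF embedding_mem])
    have "blinfun_apply embedding (real_functional ?y o\<^sub>L S) = blinfun_apply embedding v"
      by (simp add: embedding_real_functional[OF y] I(2)[OF embedding_mem] flip: T_D)
    then show "real_functional ?y o\<^sub>L S = v" by (simp add: embedding_inj)
    show "norm (real_functional ?y) \<le> onorm_on Y ?I * norm v"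
      using onorm(2)[OF _ embedding_mem, of v] by (simp add: norm_real_functional[OF y] norm_embedding)
  qed
  have "v = 0" if "v o\<^sub>L S = 0" for v :: "'z \<Rightarrow>\<^sub>L real"
  proof -
    have "blinfun_apply T (blinfun_apply embedding v) = blinfun_apply T (blinfun_apply embedding 0)"
      by (simp add: T_D that)
    then have "blinfun_apply embedding v = blinfun_apply embedding 0"
      by (rule inj_onD[OF bij_betw_imp_inj_on[OF bij] _ embedding_mem embedding_mem])
    then show ?thesis by (simp only: embedding_inj)
  qed
  then obtain S' where "S o\<^sub>L S' = id_blinfun" "S' o\<^sub>L S = id_blinfun" "norm S' \<le> onorm_on Y ?I"
    by (rule preadjoint_invertible[OF _ lift onorm(1)])
  with T_D show ?thesis by (rule that)
qed

lemma projection_factor: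
  assumes "is_projection scaleX Y P"
  obtains p :: "'a \<Rightarrow>\<^sub>L 'z \<Rightarrow>\<^sub>L real" where "P = embedding o\<^sub>L p"
    "\<And>v. blinfun_apply p (blinfun_apply embedding v) = v"
    "\<And>c x. blinfun_apply p (scaleX c x) = blinfun_apply p x o\<^sub>L Z.scaling c"
proof -
  have P: "blinfun_apply P (scaleX c x) = scaleX c (blinfun_apply P x)" "blinfun_apply P x \<in> Y"
    "y \<in> Y \<Longrightarrow> blinfun_apply P y = y" for c x y
    using assms by (auto simp: is_projection_def bounded_operators_def)
  have "bounded_linear (\<lambda>x. real_functional (blinfun_apply P x))"
    using norm_blinfun[of P]
    by (intro bounded_linear_intro[of _ "norm P"])
      (simp_all add: blinfun.bilinear_simps real_functional_add real_functional_scaleR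
        norm_real_functional P(2) mult.commute)
  note app = bounded_linear_Blinfun_apply[OF this]
  show ?thesis
  proof
    show "P = embedding o\<^sub>L Blinfun (\<lambda>x. real_functional (blinfun_apply P x))"
      by (rule blinfun_eqI) (simp add: app embedding_real_functional P(2))
  qed (simp_all add: app P embedding_mem real_functional_embedding real_functional_scale)
qed

lemma embedding_compose_projection:
  assumes "\<And>v. blinfun_apply p (blinfun_apply embedding v) = v"
    and "\<And>c x. blinfun_apply p (scaleX c x) = blinfun_apply p x o\<^sub>L Z.scaling c"
  shows "is_projection scaleX Y (embedding o\<^sub>L p)"
proof -
  have "blinfun_apply embedding (blinfun_apply p y) = y" if "y \<in> Y" for y
    using assms(1)[of "real_functional y"] that by (simp add: embedding_real_functional)
  then show ?thesis
    by (auto simp: is_projection_def bounded_operators_def embedding_mem assms(2) embedding_scaling)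
qed

lemma norm_embedding_compose:
  fixes p :: "'a \<Rightarrow>\<^sub>L 'z \<Rightarrow>\<^sub>L real"
  shows "norm (embedding o\<^sub>L p) = norm p"
  by (simp add: norm_blinfun.rep_eq onorm_def norm_embedding)

end

section \<open>Commuting projections\<close>

lemma blinfun_eq_iff: "f = g \<longleftrightarrow> (\<forall>x. blinfun_apply f x = blinfun_apply g x)"
  by (auto intro: blinfun_eqI)

text \<open>The operators \<open>S s\<close> and \<open>S' s\<close> stand for the preadjoints of \<open>\<Phi> s\<close> restricted to \<open>Y\<close> and of the inverse of
that restriction, as \<open>restriction_preadjoint\<close> provides them.\<close>

locale invariant_dual_subspace = dual_subspace scaleX scaleZ Y J
  for scaleX :: "'k::real_or_complex \<Rightarrow> 'a::banach \<Rightarrow> 'a"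
    and scaleZ :: "'k \<Rightarrow> 'z::banach \<Rightarrow> 'z" and Y J +
  fixes \<Phi> :: "'s \<Rightarrow> 'a \<Rightarrow>\<^sub>L 'a" and S S' :: "'s \<Rightarrow> 'z \<Rightarrow>\<^sub>L 'z"
  assumes operators: "\<Phi> s \<in> bounded_operators scaleX"
    and inj_on_Y: "inj_on (blinfun_apply (\<Phi> s)) Y"
    and \<Phi>_embedding: "blinfun_apply (\<Phi> s) (blinfun_apply embedding v) = blinfun_apply embedding (v o\<^sub>L S s)"
    and S_S': "S s o\<^sub>L S' s = id_blinfun" and S'_S: "S' s o\<^sub>L S s = id_blinfun"
begin

lemma \<Phi>_scale: "blinfun_apply (\<Phi> s) (scaleX c x) = scaleX c (blinfun_apply (\<Phi> s) x)"
  using operators by (auto simp: bounded_operators_def)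

lemma S_S'_apply: "blinfun_apply (S s) (blinfun_apply (S' s) z) = z"
  using arg_cong[OF S_S', of "\<lambda>f. blinfun_apply f z"] by simp

lemma S'_S_apply: "blinfun_apply (S' s) (blinfun_apply (S s) z) = z"
  using arg_cong[OF S'_S, of "\<lambda>f. blinfun_apply f z"] by simp

lemma compose_S'_S:
  fixes v :: "'z \<Rightarrow>\<^sub>L real"
  shows "(v o\<^sub>L S' s) o\<^sub>L S s = v"
  by (rule blinfun_eqI) (simp add: S'_S_apply)

lemma restriction_inverse_embedding:
  "restriction_inverse Y (\<Phi> s) (blinfun_apply embedding v) = blinfun_apply embedding (v o\<^sub>L S' s)"
proof -
  have "blinfun_apply (\<Phi> s) (blinfun_apply embedding (v o\<^sub>L S' s)) = blinfun_apply embedding v"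
    by (simp only: \<Phi>_embedding compose_S'_S)
  then show ?thesis
    unfolding restriction_inverse_def by (intro inv_into_f_eq inj_on_Y embedding_mem)
qed

text \<open>The preadjoints are obtained as real operators; they inherit linearity over the scalars from \<open>\<Phi> s\<close> because
\<open>S s\<close> is determined by its adjoint.\<close>

lemma S_scaling: "S s o\<^sub>L Z.scaling c = Z.scaling c o\<^sub>L S s"
proof (rule blinfun_eqI, rule eq_of_functionals)
  fix z and v :: "'z \<Rightarrow>\<^sub>L real"
  have "blinfun_apply embedding (v o\<^sub>L Z.scaling c o\<^sub>L S s) = blinfun_apply embedding (v o\<^sub>L S s o\<^sub>L Z.scaling c)"
    by (simp only: flip: \<Phi>_embedding) (simp only: embedding_scaling \<Phi>_scale \<Phi>_embedding)
  then have "v o\<^sub>L Z.scaling c o\<^sub>L S s = v o\<^sub>L S s o\<^sub>L Z.scaling c" by (simp only: embedding_inj)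
  from arg_cong[OF this, of "\<lambda>f. blinfun_apply f z"]
  show "blinfun_apply v (blinfun_apply (S s o\<^sub>L Z.scaling c) z)
      = blinfun_apply v (blinfun_apply (Z.scaling c o\<^sub>L S s) z)" by simp
qed

lemma S'_scaling: "S' s o\<^sub>L Z.scaling c = Z.scaling c o\<^sub>L S' s"
proof (rule blinfun_eqI)
  fix z
  have "blinfun_apply (S s) (scaleZ c (blinfun_apply (S' s) z)) = scaleZ c z"
    using arg_cong[OF S_scaling[of s c], of "\<lambda>f. blinfun_apply f (blinfun_apply (S' s) z)"]
    by (simp add: S_S'_apply)
  then show "blinfun_apply (S' s o\<^sub>L Z.scaling c) z = blinfun_apply (Z.scaling c o\<^sub>L S' s) z"
    using S'_S_apply[of s "scaleZ c (blinfun_apply (S' s) z)"] by simp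
qed

text \<open>The commuting projections as operators into the real dual. Each of the three conditions, evaluated at a point
\<open>z\<close>, is an equation between two values of the form \<open>p x z\<close> or between such a value and a constant; therefore
\<open>minimal_norm_attained\<close> applies.\<close>

definition equivariant_coordinates :: "('a \<Rightarrow>\<^sub>L 'z \<Rightarrow>\<^sub>L real) set" where
  "equivariant_coordinates = {p.
     (\<forall>v. blinfun_apply p (blinfun_apply embedding v) = v) \<and>
     (\<forall>c x. blinfun_apply p (scaleX c x) = blinfun_apply p x o\<^sub>L Z.scaling c) \<and>
     (\<forall>s x. blinfun_apply p (blinfun_apply (\<Phi> s) x) = blinfun_apply p x o\<^sub>L S s)}"

lemma is_commuting_projection_iff:
  "is_commuting_projection scaleX Y \<Phi> P \<longleftrightarrow> (\<exists>p\<in>equivariant_coordinates. P = embedding o\<^sub>L p)"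
proof -
  have commutes: "(\<forall>s. (embedding o\<^sub>L p) o\<^sub>L \<Phi> s = \<Phi> s o\<^sub>L (embedding o\<^sub>L p)) \<longleftrightarrow>
      (\<forall>s x. blinfun_apply p (blinfun_apply (\<Phi> s) x) = blinfun_apply p x o\<^sub>L S s)" for p
    by (simp add: blinfun_eq_iff[where 'a = 'a and 'b = 'a] \<Phi>_embedding embedding_inj)
  show ?thesis
  proof
    assume P: "is_commuting_projection scaleX Y \<Phi> P"
    then have "is_projection scaleX Y P" by (simp add: is_commuting_projection_def)
    then obtain p :: "'a \<Rightarrow>\<^sub>L 'z \<Rightarrow>\<^sub>L real" where p: "P = embedding o\<^sub>L p"
      "\<And>v. blinfun_apply p (blinfun_apply embedding v) = v"
      "\<And>c x. blinfun_apply p (scaleX c x) = blinfun_apply p x o\<^sub>L Z.scaling c"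
      by (rule projection_factor) (rule that)
    then have "p \<in> equivariant_coordinates"
      using P commutes[of p] by (simp add: is_commuting_projection_def equivariant_coordinates_def)
    then show "\<exists>p\<in>equivariant_coordinates. P = embedding o\<^sub>L p" using p(1) by blast
  next
    assume "\<exists>p\<in>equivariant_coordinates. P = embedding o\<^sub>L p"
    then obtain p where p: "p \<in> equivariant_coordinates" "P = embedding o\<^sub>L p" by blast
    then show "is_commuting_projection scaleX Y \<Phi> P"
      using embedding_compose_projection[of p] commutes[of p]
      by (simp add: is_commuting_projection_def equivariant_coordinates_def)
  qed
qed

lemma minimal_commuting_projection:
  assumes "\<exists>P. is_commuting_projection scaleX Y \<Phi> P"
  shows "\<exists>P\<^sub>0. is_commuting_projection scaleX Y \<Phi> P\<^sub>0 \<and>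
    (\<forall>P. is_commuting_projection scaleX Y \<Phi> P \<longrightarrow> norm P\<^sub>0 \<le> norm P)"
proof -
  define K where "K = {F :: 'a \<times> 'z \<Rightarrow> real.
    (\<forall>v z. F (blinfun_apply embedding v, z) = blinfun_apply v z) \<and>
    (\<forall>c x z. F (scaleX c x, z) = F (x, scaleZ c z)) \<and>
    (\<forall>s x z. F (blinfun_apply (\<Phi> s) x, z) = F (x, blinfun_apply (S s) z))}"
  have "closed K"
    unfolding K_def
    by (intro closed_Collect_conj closed_Collect_all closed_Collect_eq continuous_on_const
        continuous_on_product_coordinates)
  moreover have "equivariant_coordinates = {p. (\<lambda>(x, y). blinfun_apply (blinfun_apply p x) y) \<in> K}"
    by (simp add: equivariant_coordinates_def K_def blinfun_eq_iff[where 'a = 'z and 'b = real])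
  moreover have "equivariant_coordinates \<noteq> {}" using assms by (auto simp: is_commuting_projection_iff)
  ultimately obtain p where p: "p \<in> equivariant_coordinates"
    "\<And>q. q \<in> equivariant_coordinates \<Longrightarrow> norm p \<le> norm q"
    using minimal_norm_attained[of equivariant_coordinates K] by blast
  then show ?thesis
    by (intro exI[of _ "embedding o\<^sub>L p"]) (auto simp: is_commuting_projection_iff norm_embedding_compose)
qed

lemma conjugates_of_commuting_projection:
  assumes "is_commuting_projection scaleX Y \<Phi> P"
  shows "restriction_inverse Y (\<Phi> s) (blinfun_apply P (blinfun_apply (\<Phi> s) x)) = blinfun_apply P x"
proof -
  have "P o\<^sub>L \<Phi> s = \<Phi> s o\<^sub>L P" "blinfun_apply P x \<in> Y"
    using assms by (auto simp: is_commuting_projection_def is_projection_def)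
  then have "blinfun_apply P (blinfun_apply (\<Phi> s) x) = blinfun_apply (\<Phi> s) (blinfun_apply P x)"
    by (metis blinfun_apply_blinfun_compose)
  then show ?thesis
    using \<open>blinfun_apply P x \<in> Y\<close> by (simp add: restriction_inverse_def inv_into_f_f[OF inj_on_Y])
qed

lemma conjugates_bounded_by:
  assumes M: "\<And>s. onorm (\<lambda>x. restriction_inverse Y (\<Phi> s)
      (blinfun_apply (embedding o\<^sub>L q) (blinfun_apply (\<Phi> s) x))) \<le> M"
  shows "norm (blinfun_apply q (blinfun_apply (\<Phi> s) x) o\<^sub>L S' s) \<le> M * norm x"
proof -
  let ?R = "\<lambda>x. blinfun_apply embedding (blinfun_apply q (blinfun_apply (\<Phi> s) x) o\<^sub>L S' s)"
  have "bounded_linear (\<lambda>x. blinfun_apply q (blinfun_apply (\<Phi> s) x))"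
    by (rule bounded_linear_compose[OF blinfun.bounded_linear_right blinfun.bounded_linear_right])
  then have "bounded_linear (\<lambda>x. blinfun_apply q (blinfun_apply (\<Phi> s) x) o\<^sub>L S' s)"
    by (rule bounded_linear_compose[OF bounded_bilinear.bounded_linear_left[OF bounded_bilinear_blinfun_compose]])
  then have "bounded_linear ?R"
    by (rule bounded_linear_compose[OF blinfun.bounded_linear_right])
  moreover have "onorm ?R \<le> M" using M[of s] by (simp add: restriction_inverse_embedding)
  ultimately show ?thesis
    using onorm[of ?R x] mult_right_mono[of "onorm ?R" M "norm x"] by (simp add: norm_embedding)
qed

end

theorem proposition4p2:
  fixes \<Phi> :: "'s::{semigroup_mult,topological_space} \<Rightarrow> 'a::banach \<Rightarrow>\<^sub>L 'a"
    and scaleX :: "'k::real_or_complex \<Rightarrow> 'a \<Rightarrow> 'a"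
    and scaleZ :: "'k \<Rightarrow> 'z::banach \<Rightarrow> 'z"
    and Y :: "'a set"
    and J :: "'a \<Rightarrow> 'z \<Rightarrow>\<^sub>L 'k"
  assumes X: "banach_space_over scaleX"
    and T: "\<And>s. \<Phi> s \<in> bounded_operators scaleX"
    and hom: "\<And>s t. \<Phi> (s * t) = \<Phi> s o\<^sub>L \<Phi> t"
    and Y: "module.subspace scaleX Y" "closed Y"
    and p0: "(strongly_right_amenable TYPE('s) \<and> continuous_map euclidean strong_operator_topology \<Phi>) \<or>
             (weakly_right_amenable TYPE('s) \<and> continuous_on UNIV \<Phi>)"
    and p1: "\<And>s. blinfun_apply (\<Phi> s) ` Y = Y" "\<And>s. restricts_to_isomorphism Y (\<Phi> s)"
    and p2: "banach_space_over scaleZ" "isometry_onto_dual scaleX scaleZ Y J"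
    and p3: "\<And>s. continuous_map (subtopology (weak_star_topology Y J) (Y \<inter> cball 0 1))
                                 (weak_star_topology Y J) (blinfun_apply (\<Phi> s))"
    and p4: "locally_bounded (\<lambda>s. onorm_on Y (restriction_inverse Y (\<Phi> s)))"
  shows "((\<exists>P. is_commuting_projection scaleX Y \<Phi> P) \<longleftrightarrow>
          (\<exists>Q. is_projection scaleX Y Q \<and>
             bdd_above (range (\<lambda>s. onorm (\<lambda>x. restriction_inverse Y (\<Phi> s)
                                                (blinfun_apply Q (blinfun_apply (\<Phi> s) x))))))) \<and>
         ((\<exists>Q. is_projection scaleX Y Q \<and>
             bdd_above (range (\<lambda>s. onorm (\<lambda>x. restriction_inverse Y (\<Phi> s)
                                                (blinfun_apply Q (blinfun_apply (\<Phi> s) x)))))) \<longrightarrow>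
          (\<exists>P\<^sub>0. is_commuting_projection scaleX Y \<Phi> P\<^sub>0 \<and>
             (\<forall>P. is_commuting_projection scaleX Y \<Phi> P \<longrightarrow> norm P\<^sub>0 \<le> norm P)))"
proof -
  interpret dual_subspace scaleX scaleZ Y J
    using X p2(1) Y(1) p2(2)
    by (auto simp: dual_subspace_def dual_subspace_axioms_def)
  have "\<exists>R. (\<forall>v. blinfun_apply (\<Phi> s) (blinfun_apply embedding v) = blinfun_apply embedding (v o\<^sub>L fst R)) \<and>
      fst R o\<^sub>L snd R = id_blinfun \<and> snd R o\<^sub>L fst R = id_blinfun \<and>
      norm (snd R) \<le> onorm_on Y (restriction_inverse Y (\<Phi> s))" for s
    using restriction_preadjoint[OF p1(1) p1(2) p3] by (metis fst_conv snd_conv)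
  then obtain R where R: "\<And>s v. blinfun_apply (\<Phi> s) (blinfun_apply embedding v) = blinfun_apply embedding (v o\<^sub>L fst (R s))"
      "\<And>s. fst (R s) o\<^sub>L snd (R s) = id_blinfun" "\<And>s. snd (R s) o\<^sub>L fst (R s) = id_blinfun"
      "\<And>s. norm (snd (R s)) \<le> onorm_on Y (restriction_inverse Y (\<Phi> s))"
    by metis
  interpret invariant_dual_subspace scaleX scaleZ Y J \<Phi> "\<lambda>s. fst (R s)" "\<lambda>s. snd (R s)"
  proof
    show "inj_on (blinfun_apply (\<Phi> s)) Y" for s
      using p1(2)[of s] by (simp add: restricts_to_isomorphism_def bij_betw_def)
  qed (rule T R)+
  let ?bounded = "\<lambda>Q. bdd_above (range (\<lambda>s. onorm (\<lambda>x. restriction_inverse Y (\<Phi> s)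
      (blinfun_apply Q (blinfun_apply (\<Phi> s) x)))))"
  have ii: "\<exists>Q. is_projection scaleX Y Q \<and> ?bounded Q" if "is_commuting_projection scaleX Y \<Phi> P" for P
    using that conjugates_of_commuting_projection[OF that]
    by (intro exI[of _ P]) (simp add: is_commuting_projection_def)
  have i: "\<exists>P. is_commuting_projection scaleX Y \<Phi> P" if Q: "is_projection scaleX Y Q" "?bounded Q" for Q
  proof -
    obtain q :: "'a \<Rightarrow>\<^sub>L 'z \<Rightarrow>\<^sub>L real" where q: "Q = embedding o\<^sub>L q"
      "\<And>v. blinfun_apply q (blinfun_apply embedding v) = v"
      "\<And>c x. blinfun_apply q (scaleX c x) = blinfun_apply q x o\<^sub>L Z.scaling c"
      using Q(1) by (rule projection_factor) (rule that)
    obtain M where "\<And>s. onorm (\<lambda>x. restriction_inverse Y (\<Phi> s)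
        (blinfun_apply Q (blinfun_apply (\<Phi> s) x))) \<le> M"
      using Q(2) by (auto simp: bdd_above_def)
    note M = conjugates_bounded_by[of q M, folded q(1), OF this]
    interpret averaging \<Phi> embedding "\<lambda>s. fst (R s)" "\<lambda>s. snd (R s)" q M
    proof
      show "\<exists>U K. open U \<and> s \<in> U \<and> (\<forall>t\<in>U. norm (snd (R t)) \<le> K)" for s
      proof -
        obtain U where U: "open U" "s \<in> U" "bounded ((\<lambda>s. onorm_on Y (restriction_inverse Y (\<Phi> s))) ` U)"
          using p4 by (auto simp: locally_bounded_def)
        then obtain K where "\<And>t. t \<in> U \<Longrightarrow> \<bar>onorm_on Y (restriction_inverse Y (\<Phi> t))\<bar> \<le> K"
          by (auto simp: bounded_iff)
        then have "norm (snd (R t)) \<le> K" if "t \<in> U" for t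
          using R(4)[of t] that by fastforce
        with U show ?thesis by blast
      qed
      show "continuous_on UNIV (\<lambda>s. blinfun_apply (\<Phi> s) x)" for x
        using p0 by (auto simp: continuous_on_strong_operator_topo_iff_coordinatewise
            intro: continuous_intros)
    qed (simp_all add: hom norm_embedding R M)
    obtain p :: "'a \<Rightarrow>\<^sub>L 'z \<Rightarrow>\<^sub>L real"
      where p: "\<And>v. blinfun_apply p (blinfun_apply embedding v) = v"
        "\<And>s x. blinfun_apply p (blinfun_apply (\<Phi> s) x) = blinfun_apply p x o\<^sub>L fst (R s)"
        and intertwine: "\<And>\<sigma> \<tau> x. \<lbrakk>\<And>s. \<Phi> s o\<^sub>L \<sigma> = \<sigma> o\<^sub>L \<Phi> s; \<And>s. snd (R s) o\<^sub>L \<tau> = \<tau> o\<^sub>L snd (R s);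
          \<And>x. blinfun_apply q (blinfun_apply \<sigma> x) = blinfun_apply q x o\<^sub>L \<tau>\<rbrakk>
          \<Longrightarrow> blinfun_apply p (blinfun_apply \<sigma> x) = blinfun_apply p x o\<^sub>L \<tau>"
      using equivariant_average[OF _ q(2)] p0 by blast
    have "blinfun_apply p (scaleX c x) = blinfun_apply p x o\<^sub>L Z.scaling c" for c x
      using intertwine[of "X.scaling c" "Z.scaling c" x] S'_scaling
      by (simp add: q(3) blinfun_eq_iff[where 'a = 'a and 'b = 'a] \<Phi>_scale)
    then have "p \<in> equivariant_coordinates" using p by (simp add: equivariant_coordinates_def)
    then show ?thesis by (auto simp: is_commuting_projection_iff)
  qed
  show ?thesis
  proof (intro conjI iffI impI)
    assume "\<exists>P. is_commuting_projection scaleX Y \<Phi> P"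
    then show "\<exists>Q. is_projection scaleX Y Q \<and> ?bounded Q" by (elim exE) (rule ii)
  next
    assume "\<exists>Q. is_projection scaleX Y Q \<and> ?bounded Q"
    then show "\<exists>P. is_commuting_projection scaleX Y \<Phi> P" by (elim exE conjE) (rule i)
  next
    assume "\<exists>Q. is_projection scaleX Y Q \<and> ?bounded Q"
    then have "\<exists>P. is_commuting_projection scaleX Y \<Phi> P" by (elim exE conjE) (rule i)
    then show "\<exists>P\<^sub>0. is_commuting_projection scaleX Y \<Phi> P\<^sub>0 \<and>
        (\<forall>P. is_commuting_projection scaleX Y \<Phi> P \<longrightarrow> norm P\<^sub>0 \<le> norm P)"
      by (rule minimal_commuting_projection)
  qed
qed

end
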